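(* Let $(\mathcal G_1,e_1)$, $(\mathcal G_2,e_2)$ be rooted graphs with spectral distributions $\mu_1,\mu_2$, let their orthogonal loop product $\mathcal G_1\vdash_\ell\mathcal G_2$ (with root $e$) be naturally colored, and let $A(\mathcal G_1\vdash_\ell\mathcal G_2)=R_1+R_2$ be the decomposition of its adjacency matrix induced by the coloring. Put $Z=R_2R_1$. Then for every $n\in\mathbb N$ $$N_Z(n)=N_{\mu_1\angle\mu_2}(n)=|D_{2n}(e)|,$$ where $N_Z(n)$ refers to the state $\varphi_e$ and $D_{2n}(e)$ is the set of rooted alternating d-walks of length $2n$ on $\mathcal G_1\vdash_\ell\mathcal G_2$. Moreover, the pair $(R_1-1,R_2-1)$ is orthogonal with respect to $(\varphi_e,\psi)$, where $\psi$ is the state associated with any unit vector in $\ell^2(V_1\setminus\{e_1\})$ ($V_1\setminus\{e_1\}$ being regarded as the set of non-root vertices of the copy of $\mathcal G_1$ in the product).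
   Context: Graphs are non-oriented, connected, uniformly locally finite (bounded degrees), with a root, possibly with loops and multiple edges. The adjacency matrix of $\mathcal G$ is the operator $A(\mathcal G)\delta(x)=\sum_{x'\sim x}n(x,x')\delta(x')$ on $\ell^2(V)$, $n(x,x')$ being the number of edges joining $x,x'$ (a loop at $x$ contributes $1$ to $n(x,x)$). The state associated with a unit vector $\zeta$ is $\langle\cdot\,\zeta,\zeta\rangle$; $\varphi_e$ is the state associated with $\delta(e)$; the spectral distribution of $(\mathcal G,e)$ is the distribution of $A(\mathcal G)$ in $\varphi_e$. Orthogonal product $\mathcal G_1\vdash\mathcal G_2$: attach a copy of $\mathcal G_2$ by its root to each vertex of $\mathcal G_1$ but the root $e_1$; the root is $e=e_1$. Natural coloring: edges of each copy of $\mathcal G_\iota$ get color $\iota\in\{1,2\}$. Orthogonal loop product $\mathcal G_1\vdash_\ell\mathcal G_2$: obtained from the naturally colored orthogonal product by attaching a loop of color $1$ to all vertices but the root of each copy of $\mathcal G_2$, and a loop of color $2$ to the root of $\mathcal G_1$. $R_\iota$ is the adjacency matrix of the subgraph of edges of color $\iota$. A walk from $v_0$ to $v_n$ is a sequence $(v_0,\beta_1,v_1,\dots,\beta_n,v_n)$, $\beta_i$ an edge joining $v_{i-1}$ and $v_i$; its length is $n$. An f-walk from $v$ to $v$ is a walk with $v_0=v_n=v$ and $v_i\neq v$ for $1\le i\le n-1$. A walk is alternating if the colors of its successive edges alternate. An alternating d-walk from $v$ to $v$ is an alternating walk beginning with an edge of color $1$ which is the concatenation $(u_1,u_2)$ of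 two f-walks from $v$ to $v$. Rooted means $v=e$. For a unital functional $\mu$ on $\mathbb C[X]$ ($\mu(1)=1$; compactly supported measures are identified with their moment functionals) put $\psi_\mu(z)=\sum_{n\ge1}\mu(X^n)z^n$, $\eta_\mu=\psi_\mu/(1+\psi_\mu)=\sum_{n\ge1}N_\mu(n)z^n$ (formal power series; $\eta_\mu$ determines $\mu$), $\rho_\mu(z)=\eta_\mu(z)/z$. For a random variable $Z$ and a state, $N_Z(n)=N_\mu(n)$ with $\mu$ the distribution of $Z$ in that state. Orthogonal multiplicative convolution: $\eta_{\mu_1\angle\mu_2}(z)=z\rho_{\mu_1}(\eta_{\mu_2}(z))$, i.e. $z\eta_{\mu_1}(\eta_{\mu_2}(z))/\eta_{\mu_2}(z)$ when $\eta_{\mu_2}\ne0$. A pair $(a,b)$ is orthogonal w.r.t. $(\varphi,\psi)$ if, with $\mathcal A_1,\mathcal A_2$ the non-unital algebras generated by $a$ and by $b$, (i) $\varphi(b'w_2)=\varphi(w_1b')=0$, and (ii) $\varphi(w_1a_1b'a_2w_2)=\psi(b')\big(\varphi(w_1a_1a_2w_2)-\varphi(w_1a_1)\varphi(a_2w_2)\big)$, for all $a_1,a_2\in\mathcal A_1$, $b'\in\mathcal A_2$ and $w_1,w_2$ in the unital algebra generated by $\mathcal A_1,\mathcal A_2$. *)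

theory Defs
  imports "HOL-Analysis.Analysis" "HOL-Computational_Algebra.Polynomial"
    "HOL-Computational_Algebra.Formal_Power_Series"
begin

section \<open>Rooted multigraphs\<close>

text \<open>
  Non-oriented graphs, possibly with loops and multiple edges: edges have an identity of their
  own, and the set of ends of an edge has two elements, or one if the edge is a loop.
\<close>

record ('v, 'e) rgraph =
  verts :: "'v set"
  edges :: "'e set"
  ends :: "'e \<Rightarrow> 'v set"
  base :: 'v

record ('v, 'e) cgraph = "('v, 'e) rgraph" +
  color :: "'e \<Rightarrow> nat"

definition joins :: "('v, 'e, 'z) rgraph_scheme \<Rightarrow> 'e \<Rightarrow> 'v \<Rightarrow> 'v \<Rightarrow> bool" where
  "joins G b x y \<longleftrightarrow> b \<in> edges G \<and> ends G b = {x, y}"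

definition n_edges :: "('v, 'e, 'z) rgraph_scheme \<Rightarrow> 'v \<Rightarrow> 'v \<Rightarrow> nat" where
  "n_edges G x y = card {b. joins G b x y}"

text \<open>The walk \<open>(v\<^sub>0, b\<^sub>1, v\<^sub>1, \<dots>, b\<^sub>n, v\<^sub>n)\<close> is the pair \<open>([v\<^sub>0, \<dots>, v\<^sub>n], [b\<^sub>1, \<dots>, b\<^sub>n])\<close>.\<close>

type_synonym ('v, 'e) walk = "'v list \<times> 'e list"

definition is_walk :: "('v, 'e, 'z) rgraph_scheme \<Rightarrow> ('v, 'e) walk \<Rightarrow> bool" where
  "is_walk G w \<longleftrightarrow> (case w of (vs, bs) \<Rightarrow>
     length vs = length bs + 1 \<and> set vs \<subseteq> verts G \<and>
     (\<forall>i < length bs. joins G (bs ! i) (vs ! i) (vs ! Suc i)))"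

definition walk_length :: "('v, 'e) walk \<Rightarrow> nat" where
  "walk_length w = length (snd w)"

definition walk_from_to :: "('v, 'e, 'z) rgraph_scheme \<Rightarrow> 'v \<Rightarrow> 'v \<Rightarrow> ('v, 'e) walk \<Rightarrow> bool" where
  "walk_from_to G x y w \<longleftrightarrow> is_walk G w \<and> hd (fst w) = x \<and> last (fst w) = y"

definition multigraph :: "('v, 'e, 'z) rgraph_scheme \<Rightarrow> bool" where
  "multigraph G \<longleftrightarrow> (\<forall>b\<in>edges G. \<exists>x\<in>verts G. \<exists>y\<in>verts G. ends G b = {x, y})"

definition connected_graph :: "('v, 'e, 'z) rgraph_scheme \<Rightarrow> bool" where
  "connected_graph G \<longleftrightarrow> (\<forall>x\<in>verts G. \<forall>y\<in>verts G. \<exists>w. walk_from_to G x y w)"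

definition degree_bound :: "('v, 'e, 'z) rgraph_scheme \<Rightarrow> nat \<Rightarrow> bool" where
  "degree_bound G d \<longleftrightarrow>
     (\<forall>x\<in>verts G. finite {b\<in>edges G. x \<in> ends G b} \<and> card {b\<in>edges G. x \<in> ends G b} \<le> d)"

definition rooted_graph :: "('v, 'e, 'z) rgraph_scheme \<Rightarrow> bool" where
  "rooted_graph G \<longleftrightarrow>
     multigraph G \<and> base G \<in> verts G \<and> connected_graph G \<and> (\<exists>d. degree_bound G d)"


section \<open>Operators on \<open>\<ell>\<^sup>2(V)\<close>, states, distributions\<close>

definition ell2 :: "'v set \<Rightarrow> ('v \<Rightarrow> complex) set" where
  "ell2 V = {f. (\<forall>x. x \<notin> V \<longrightarrow> f x = 0) \<and> (\<lambda>x. (cmod (f x))\<^sup>2) summable_on UNIV}"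

definition ell2_inner :: "('v \<Rightarrow> complex) \<Rightarrow> ('v \<Rightarrow> complex) \<Rightarrow> complex" where
  "ell2_inner f g = (\<Sum>\<^sub>\<infinity>x. f x * cnj (g x))"

definition delta :: "'v \<Rightarrow> 'v \<Rightarrow> complex" where
  "delta x = (\<lambda>y. if y = x then 1 else 0)"

type_synonym 'v oper = "('v \<Rightarrow> complex) \<Rightarrow> ('v \<Rightarrow> complex)"

text \<open>
  In a uniformly locally finite graph, the formula below is a finite sum for every function on the
  vertices. Its restriction to \<open>\<ell>\<^sup>2(V)\<close> is the bounded operator with
  \<open>A \<delta>(x) = \<Sum>\<^sub>x\<^sub>' n(x, x') \<delta>(x')\<close>: see lemmas \<open>adj_delta\<close> and \<open>adj_ell2\<close>.
\<close>

definition adj :: "('v, 'e, 'z) rgraph_scheme \<Rightarrow> 'v oper" where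
  "adj G f = (\<lambda>y. \<Sum>x | x \<in> verts G \<and> n_edges G x y \<noteq> 0. of_nat (n_edges G x y) * f x)"

definition vec_state :: "('v \<Rightarrow> complex) \<Rightarrow> 'v oper \<Rightarrow> complex" where
  "vec_state \<zeta> T = ell2_inner (T \<zeta>) \<zeta>"

text \<open>Distributions are functionals on \<open>\<complex>[X]\<close>; this is \<open>p \<mapsto> \<phi>(p(T))\<close>.\<close>

definition distribution :: "('v oper \<Rightarrow> complex) \<Rightarrow> 'v oper \<Rightarrow> complex poly \<Rightarrow> complex" where
  "distribution \<phi> T p = \<phi> (\<lambda>f x. \<Sum>i\<le>degree p. coeff p i * (T ^^ i) f x)"

definition spectral_distribution :: "('v, 'e, 'z) rgraph_scheme \<Rightarrow> complex poly \<Rightarrow> complex" where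
  "spectral_distribution G = distribution (vec_state (delta (base G))) (adj G)"


section \<open>Transforms and the orthogonal multiplicative convolution\<close>

definition unital_functional :: "(complex poly \<Rightarrow> complex) \<Rightarrow> bool" where
  "unital_functional \<mu> \<longleftrightarrow>
     (\<forall>p q. \<mu> (p + q) = \<mu> p + \<mu> q) \<and> (\<forall>c p. \<mu> (smult c p) = c * \<mu> p) \<and> \<mu> 1 = 1"

definition psi_series :: "(complex poly \<Rightarrow> complex) \<Rightarrow> complex fps" where
  "psi_series \<mu> = Abs_fps (\<lambda>n. if n = 0 then 0 else \<mu> (monom 1 n))"

definition eta_series :: "(complex poly \<Rightarrow> complex) \<Rightarrow> complex fps" where
  "eta_series \<mu> = psi_series \<mu> / (1 + psi_series \<mu>)"

definition N_coeff :: "(complex poly \<Rightarrow> complex) \<Rightarrow> nat \<Rightarrow> complex" where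
  "N_coeff \<mu> n = fps_nth (eta_series \<mu>) n"

definition rho_series :: "(complex poly \<Rightarrow> complex) \<Rightarrow> complex fps" where
  "rho_series \<mu> = eta_series \<mu> / fps_X"

text \<open>Existence and uniqueness of this functional: lemma \<open>ex1_functional_eta\<close>.\<close>

definition orth_mult_conv ::
  "(complex poly \<Rightarrow> complex) \<Rightarrow> (complex poly \<Rightarrow> complex) \<Rightarrow> complex poly \<Rightarrow> complex" where
  "orth_mult_conv \<mu>1 \<mu>2 =
     (THE \<mu>. unital_functional \<mu> \<and>
        eta_series \<mu> = fps_X * (rho_series \<mu>1 oo eta_series \<mu>2))"


section \<open>Orthogonal pairs\<close>

inductive_set gen_alg :: "'v oper set \<Rightarrow> 'v oper set" for S :: "'v oper set" where
  gen: "T \<in> S \<Longrightarrow> T \<in> gen_alg S"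
| zero: "(\<lambda>f x. 0) \<in> gen_alg S"
| add: "T \<in> gen_alg S \<Longrightarrow> U \<in> gen_alg S \<Longrightarrow> (\<lambda>f x. T f x + U f x) \<in> gen_alg S"
| scale: "T \<in> gen_alg S \<Longrightarrow> (\<lambda>f x. c * T f x) \<in> gen_alg S"
| comp: "T \<in> gen_alg S \<Longrightarrow> U \<in> gen_alg S \<Longrightarrow> T \<circ> U \<in> gen_alg S"

definition orthogonal_pair ::
  "'v oper \<Rightarrow> 'v oper \<Rightarrow> ('v oper \<Rightarrow> complex) \<Rightarrow> ('v oper \<Rightarrow> complex) \<Rightarrow> bool" where
  "orthogonal_pair a b \<phi> \<psi> \<longleftrightarrow>
     (let A1 = gen_alg {a}; A2 = gen_alg {b}; W = gen_alg (insert id (A1 \<union> A2)) in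
        (\<forall>b'\<in>A2. \<forall>w1\<in>W. \<forall>w2\<in>W. \<phi> (b' \<circ> w2) = 0 \<and> \<phi> (w1 \<circ> b') = 0) \<and>
        (\<forall>a1\<in>A1. \<forall>a2\<in>A1. \<forall>b'\<in>A2. \<forall>w1\<in>W. \<forall>w2\<in>W.
           \<phi> (w1 \<circ> a1 \<circ> b' \<circ> a2 \<circ> w2) =
             \<psi> b' * (\<phi> (w1 \<circ> a1 \<circ> a2 \<circ> w2) - \<phi> (w1 \<circ> a1) * \<phi> (a2 \<circ> w2))))"


section \<open>Orthogonal product and orthogonal loop product\<close>

text \<open>
  The vertex \<open>(x, y)\<close> is the vertex \<open>y\<close> of the copy of the second graph attached at \<open>x\<close>; the
  vertex \<open>x\<close> of the first graph is \<open>(x, e\<^sub>2)\<close>, and nothing is attached at \<open>e\<^sub>1\<close>. The edge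
  \<open>Inr (x, b)\<close> is the edge \<open>b\<close> of the copy attached at \<open>x\<close>.
\<close>

definition orth_product ::
  "('v1, 'e1) rgraph \<Rightarrow> ('v2, 'e2) rgraph \<Rightarrow> ('v1 \<times> 'v2, 'e1 + 'v1 \<times> 'e2) cgraph" where
  "orth_product G1 G2 =
     \<lparr>verts = {(x, y). x \<in> verts G1 \<and> y \<in> verts G2 \<and> (x = base G1 \<longrightarrow> y = base G2)},
      edges = Inl ` edges G1 \<union> Inr ` ((verts G1 - {base G1}) \<times> edges G2),
      ends = (\<lambda>b. case b of Inl b1 \<Rightarrow> (\<lambda>x. (x, base G2)) ` ends G1 b1
                         | Inr (x, b2) \<Rightarrow> Pair x ` ends G2 b2),
      base = (base G1, base G2),
      color = (\<lambda>b. case b of Inl _ \<Rightarrow> 1 | Inr _ \<Rightarrow> 2)\<rparr>"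

datatype ('v, 'e) with_loops = Edge 'e | Loop nat 'v

definition attach_loops ::
  "('v, 'e) cgraph \<Rightarrow> (nat \<times> 'v) set \<Rightarrow> ('v, ('v, 'e) with_loops) cgraph" where
  "attach_loops G L =
     \<lparr>verts = verts G,
      edges = Edge ` edges G \<union> (\<lambda>(i, v). Loop i v) ` L,
      ends = (\<lambda>b. case b of Edge b' \<Rightarrow> ends G b' | Loop _ v \<Rightarrow> {v}),
      base = base G,
      color = (\<lambda>b. case b of Edge b' \<Rightarrow> color G b' | Loop i _ \<Rightarrow> i)\<rparr>"

definition orth_loop_product ::
  "('v1, 'e1) rgraph \<Rightarrow> ('v2, 'e2) rgraph \<Rightarrow>
   ('v1 \<times> 'v2, ('v1 \<times> 'v2, 'e1 + 'v1 \<times> 'e2) with_loops) cgraph" where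
  "orth_loop_product G1 G2 =
     attach_loops (orth_product G1 G2)
       ({(1, (x, y)) | x y. (x, y) \<in> verts (orth_product G1 G2) \<and> y \<noteq> base G2}
        \<union> {(2, base (orth_product G1 G2))})"

definition color_subgraph :: "('v, 'e) cgraph \<Rightarrow> nat \<Rightarrow> ('v, 'e) cgraph" where
  "color_subgraph G i = G\<lparr>edges := {b\<in>edges G. color G b = i}\<rparr>"

definition color_adj :: "('v, 'e) cgraph \<Rightarrow> nat \<Rightarrow> 'v oper" where
  "color_adj G i = adj (color_subgraph G i)"

text \<open>The vector of \<open>\<ell>\<^sup>2\<close> of the product which is \<open>\<zeta>\<close> on the copy of \<open>V\<^sub>1\<close> and vanishes elsewhere.\<close>

definition embed1 :: "('v2, 'e2) rgraph \<Rightarrow> ('v1 \<Rightarrow> complex) \<Rightarrow> 'v1 \<times> 'v2 \<Rightarrow> complex" where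
  "embed1 G2 \<zeta> = (\<lambda>(x, y). if y = base G2 then \<zeta> x else 0)"


section \<open>Alternating d-walks\<close>

definition f_walk :: "('v, 'e, 'z) rgraph_scheme \<Rightarrow> 'v \<Rightarrow> ('v, 'e) walk \<Rightarrow> bool" where
  "f_walk G v w \<longleftrightarrow> walk_from_to G v v w \<and> walk_length w \<ge> 1 \<and>
     (\<forall>i. 1 \<le> i \<and> i < walk_length w \<longrightarrow> fst w ! i \<noteq> v)"

definition walk_append :: "('v, 'e) walk \<Rightarrow> ('v, 'e) walk \<Rightarrow> ('v, 'e) walk" where
  "walk_append u w = (fst u @ tl (fst w), snd u @ snd w)"

definition alternating :: "('v, 'e) cgraph \<Rightarrow> ('v, 'e) walk \<Rightarrow> bool" where
  "alternating G w \<longleftrightarrow>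
     (\<forall>i. Suc i < walk_length w \<longrightarrow> color G (snd w ! i) \<noteq> color G (snd w ! Suc i))"

definition alternating_d_walk :: "('v, 'e) cgraph \<Rightarrow> 'v \<Rightarrow> ('v, 'e) walk \<Rightarrow> bool" where
  "alternating_d_walk G v w \<longleftrightarrow>
     is_walk G w \<and> alternating G w \<and> color G (hd (snd w)) = 1 \<and>
     (\<exists>u1 u2. f_walk G v u1 \<and> f_walk G v u2 \<and> w = walk_append u1 u2)"

definition d_walks :: "('v, 'e) cgraph \<Rightarrow> 'v \<Rightarrow> nat \<Rightarrow> ('v, 'e) walk set" where
  "d_walks G v m = {w. alternating_d_walk G v w \<and> walk_length w = m}"


section \<open>Well-definedness\<close>

lemma ex1_functional_eta:
  fixes h :: "complex fps"
  assumes "fps_nth h 0 = 0"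
  shows "\<exists>!\<mu>. unital_functional \<mu> \<and> eta_series \<mu> = h"
proof -
  have u: "fps_nth (1 - h) 0 \<noteq> 0" using assms by simp
  define s where "s = h * inverse (1 - h)"
  have s0: "fps_nth s 0 = 0" by (simp add: s_def assms)
  have inv1: "(1 - h) * inverse (1 - h) = 1"
    using u inverse_mult_eq_1' by blast
  have s1: "1 + s = inverse (1 - h)"
  proof -
    have "inverse (1 - h) = (1 - h) * inverse (1 - h) + h * inverse (1 - h)"
      by (simp add: algebra_simps)
    then show ?thesis by (simp add: s_def inv1)
  qed
  have div_iff: "t / (1 + t) = h \<longleftrightarrow> t = s" if t0: "fps_nth t 0 = 0" for t :: "complex fps"
  proof -
    have ut: "fps_nth (1 + t) 0 \<noteq> 0" using t0 by simp
    have e: "(1 + t) * inverse (1 + t) = 1" using ut inverse_mult_eq_1' by blast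
    have d: "t / (1 + t) = t * inverse (1 + t)" using ut by (simp add: fps_divide_unit)
    show ?thesis
    proof
      assume h: "t / (1 + t) = h"
      have "h * (1 + t) = t * inverse (1 + t) * (1 + t)" using d h by metis
      also have "\<dots> = t * ((1 + t) * inverse (1 + t))" by (simp only: mult_ac)
      also have "\<dots> = t" by (simp only: e mult_1_right)
      finally have "t = h * (1 + t)" by simp
      then have "t * (1 - h) = h" by (simp add: algebra_simps)
      then have "t * ((1 - h) * inverse (1 - h)) = h * inverse (1 - h)"
        by (simp add: mult.assoc[symmetric])
      then show "t = s" by (simp add: s_def inv1)
    next
      assume t: "t = s"
      have "s = h * (1 + s)" using s1 by (simp add: s_def)
      then have "t * inverse (1 + t) = h * ((1 + t) * inverse (1 + t))"
        by (metis t mult.assoc)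
      then show "t / (1 + t) = h" using e d by simp
    qed
  qed
  have psi0: "fps_nth (psi_series \<mu>) 0 = 0" for \<mu> by (simp add: psi_series_def)
  define m where "m = (\<lambda>n. fps_nth (1 + s) n)"
  define \<mu> where "\<mu> = (\<lambda>p::complex poly. \<Sum>i\<le>degree p. coeff p i * m i)"
  have mu_ge: "\<mu> p = (\<Sum>i\<le>N. coeff p i * m i)" if "degree p \<le> N" for p N
    unfolding \<mu>_def
    by (rule sum.mono_neutral_left) (use that in \<open>auto simp: coeff_eq_0\<close>)
  have mon: "\<mu> (monom 1 n) = m n" for n
    by (simp add: \<mu>_def degree_monom_eq if_distrib[of "\<lambda>c. c * _"] cong: if_cong)
  have unit: "unital_functional \<mu>"
    unfolding unital_functional_def
  proof (intro conjI allI)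
    fix p q :: "complex poly"
    let ?N = "max (degree p) (degree q)"
    have "\<mu> (p + q) = (\<Sum>i\<le>?N. coeff (p + q) i * m i)"
      by (rule mu_ge) (simp add: degree_add_le_max)
    also have "\<dots> = (\<Sum>i\<le>?N. coeff p i * m i) + (\<Sum>i\<le>?N. coeff q i * m i)"
      by (simp add: distrib_right sum.distrib)
    also have "\<dots> = \<mu> p + \<mu> q" using mu_ge[of p ?N] mu_ge[of q ?N] by simp
    finally show "\<mu> (p + q) = \<mu> p + \<mu> q" .
  next
    fix c :: complex and p :: "complex poly"
    have "\<mu> (smult c p) = (\<Sum>i\<le>degree p. coeff (smult c p) i * m i)"
      by (rule mu_ge) (simp add: degree_smult_le)
    then show "\<mu> (smult c p) = c * \<mu> p"
      by (simp add: \<mu>_def sum_distrib_left mult.assoc)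
  next
    show "\<mu> 1 = 1" using mon[of 0] s0 by (simp add: monom_0 m_def flip: one_pCons)
  qed
  have "psi_series \<mu> = s"
    by (rule fps_ext) (auto simp: psi_series_def mon m_def s0)
  then have "eta_series \<mu> = h" using div_iff[OF s0] by (simp add: eta_series_def)
  moreover have "\<nu> = \<mu>" if \<nu>: "unital_functional \<nu> \<and> eta_series \<nu> = h" for \<nu>
  proof -
    have ps: "psi_series \<nu> = s" using div_iff[OF psi0] \<nu> by (simp add: eta_series_def)
    have add: "\<nu> (p + q) = \<nu> p + \<nu> q" and sm: "\<nu> (smult c p) = c * \<nu> p" and one: "\<nu> 1 = 1"
      for p q c using \<nu> by (auto simp: unital_functional_def)
    have z: "\<nu> 0 = 0" using sm[of 0 0] by simp
    have mn: "\<nu> (monom 1 n) = m n" for n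
    proof (cases "n = 0")
      case True
      then show ?thesis using one s0 by (simp add: m_def monom_0 flip: one_pCons)
    next
      case False
      then have "\<nu> (monom 1 n) = fps_nth (psi_series \<nu>) n" by (simp add: psi_series_def)
      then show ?thesis using ps False by (simp add: m_def)
    qed
    have sums: "\<nu> (\<Sum>i\<in>I. f i) = (\<Sum>i\<in>I. \<nu> (f i))" if "finite I"
      for I :: "nat set" and f using that by (induction I) (auto simp: add z)
    have "\<nu> p = \<mu> p" for p
    proof -
      have "p = (\<Sum>i\<le>degree p. smult (coeff p i) (monom 1 i))"
        by (simp add: smult_monom poly_as_sum_of_monoms)
      then have "\<nu> p = (\<Sum>i\<le>degree p. coeff p i * m i)"
        by (metis (no_types, lifting) sums[of "{..degree p}"] sm mn sum.cong finite_atMost)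
      then show ?thesis by (simp add: \<mu>_def)
    qed
    then show ?thesis by auto
  qed
  ultimately show ?thesis using unit by blast
qed

lemma orth_mult_conv:
  "unital_functional (orth_mult_conv \<mu>1 \<mu>2)"
  "eta_series (orth_mult_conv \<mu>1 \<mu>2) = fps_X * (rho_series \<mu>1 oo eta_series \<mu>2)"
  using theI'[OF ex1_functional_eta[of "fps_X * (rho_series \<mu>1 oo eta_series \<mu>2)"]]
  by (simp_all add: orth_mult_conv_def)

lemma multigraph_joins:
  assumes "multigraph G" "joins G b x y"
  shows "x \<in> verts G" "y \<in> verts G"
proof -
  obtain u v where "u \<in> verts G" "v \<in> verts G" "ends G b = {u, v}"
    using assms by (auto simp: multigraph_def joins_def)
  with assms(2) have "{x, y} = {u, v}" by (simp add: joins_def)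
  then show "x \<in> verts G" "y \<in> verts G"
    using \<open>u \<in> verts G\<close> \<open>v \<in> verts G\<close> by (auto simp: doubleton_eq_iff)
qed

lemma n_edges_commute: "n_edges G x y = n_edges G y x"
  by (simp add: n_edges_def joins_def insert_commute)

lemma n_edges_outside:
  assumes "multigraph G" "x \<notin> verts G \<or> y \<notin> verts G"
  shows "n_edges G x y = 0"
proof -
  have "{b. joins G b x y} = {}" using multigraph_joins[OF assms(1)] assms(2) by blast
  then show ?thesis by (simp only: n_edges_def card.empty)
qed

lemma finite_joins:
  assumes "multigraph G" "degree_bound G d"
  shows "finite {b. joins G b x y}"
proof (cases "x \<in> verts G")
  case True
  then have "finite {b\<in>edges G. x \<in> ends G b}" using assms by (auto simp: degree_bound_def)
  moreover have "{b. joins G b x y} \<subseteq> {b\<in>edges G. x \<in> ends G b}" by (auto simp: joins_def)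
  ultimately show ?thesis by (rule rev_finite_subset)
next
  case False
  then have "{b. joins G b x y} = {}" using multigraph_joins[OF assms(1)] by auto
  then show ?thesis by simp
qed

lemma sum_n_edges_le:
  assumes "multigraph G" "degree_bound G d" "finite S"
  shows "(\<Sum>y\<in>S. n_edges G x y) \<le> d"
proof (cases "x \<in> verts G")
  case True
  have "(\<Sum>y\<in>S. n_edges G x y) = card (\<Union>y\<in>S. {b. joins G b x y})"
    unfolding n_edges_def
    by (rule card_UN_disjoint[symmetric])
       (use assms finite_joins[OF assms(1,2)] in \<open>auto simp: joins_def doubleton_eq_iff\<close>)
  also have "\<dots> \<le> card {b\<in>edges G. x \<in> ends G b}"
    by (rule card_mono) (use assms True in \<open>auto simp: degree_bound_def joins_def\<close>)
  also have "\<dots> \<le> d" using assms True by (auto simp: degree_bound_def)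
  finally show ?thesis .
next
  case False
  then have "n_edges G x y = 0" for y
    using n_edges_outside[OF assms(1)] by blast
  then show ?thesis by simp
qed

lemma finite_neighbours:
  assumes "multigraph G" "degree_bound G d"
  shows "finite {y \<in> verts G. n_edges G x y \<noteq> 0}"
proof (rule ccontr)
  assume "infinite {y \<in> verts G. n_edges G x y \<noteq> 0}"
  then obtain S where S: "S \<subseteq> {y \<in> verts G. n_edges G x y \<noteq> 0}" "finite S" "card S = Suc d"
    using infinite_arbitrarily_large by blast
  have "card S = (\<Sum>y\<in>S. 1)" by simp
  also have "\<dots> \<le> (\<Sum>y\<in>S. n_edges G x y)" by (rule sum_mono) (use S in auto)
  also have "\<dots> \<le> d" by (rule sum_n_edges_le[OF assms S(2)])
  finally show False using S(3) by simp
qed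

lemma adj_delta:
  assumes "multigraph G" "degree_bound G d" "x \<in> verts G"
  shows "adj G (delta x) =
    (\<lambda>y. \<Sum>x' | x' \<in> verts G \<and> n_edges G x x' \<noteq> 0. of_nat (n_edges G x x') * delta x' y)"
proof
  fix y
  have fin: "finite {u \<in> verts G. n_edges G u y \<noteq> 0}" "finite {u \<in> verts G. n_edges G x u \<noteq> 0}"
    using finite_neighbours[OF assms(1,2)] by (simp_all add: n_edges_commute[of G _ y])
  have "adj G (delta x) y
      = (\<Sum>u | u \<in> verts G \<and> n_edges G u y \<noteq> 0. if u = x then of_nat (n_edges G x y) else 0)"
    unfolding adj_def delta_def by (rule sum.cong) auto
  also have "\<dots> = of_nat (n_edges G x y)"
    using assms(3) by (subst sum.delta[OF fin(1)]) auto
  also have "\<dots> = (\<Sum>u | u \<in> verts G \<and> n_edges G x u \<noteq> 0.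
      if u = y then of_nat (n_edges G x y) else 0)"
    using n_edges_outside[OF assms(1), of x y] by (subst sum.delta[OF fin(2)]) auto
  also have "\<dots> = (\<Sum>x' | x' \<in> verts G \<and> n_edges G x x' \<noteq> 0.
      of_nat (n_edges G x x') * delta x' y)"
    unfolding delta_def by (rule sum.cong) auto
  finally show "adj G (delta x) y =
      (\<Sum>x' | x' \<in> verts G \<and> n_edges G x x' \<noteq> 0. of_nat (n_edges G x x') * delta x' y)" .
qed

text \<open>The adjacency operator preserves \<open>\<ell>\<^sup>2(V)\<close> and its norm there is at most the maximal degree.\<close>

lemma adj_ell2:
  assumes G: "multigraph G" "degree_bound G d" and f: "f \<in> ell2 (verts G)"
  shows "adj G f \<in> ell2 (verts G)"
    and "(\<Sum>\<^sub>\<infinity>x. (cmod (adj G f x))\<^sup>2) \<le> (real d)\<^sup>2 * (\<Sum>\<^sub>\<infinity>x. (cmod (f x))\<^sup>2)"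
proof -
  have sf: "(\<lambda>x. (cmod (f x))\<^sup>2) summable_on UNIV" using f by (simp add: ell2_def)
  define N where "N = (\<lambda>y. {x \<in> verts G. n_edges G x y \<noteq> 0})"
  have finN: "finite (N y)" for y
    using finite_neighbours[OF G, of y] by (simp add: N_def n_edges_commute[of G _ y])
  have pt: "(cmod (adj G f y))\<^sup>2 \<le> real d * (\<Sum>x\<in>N y. real (n_edges G x y) * (cmod (f x))\<^sup>2)" for y
  proof -
    have "cmod (adj G f y) \<le> (\<Sum>x\<in>N y. real (n_edges G x y) * cmod (f x))"
      unfolding adj_def N_def by (rule order_trans[OF norm_sum]) (simp add: norm_mult)
    also have "\<dots> = (\<Sum>x\<in>N y. sqrt (n_edges G x y) * (sqrt (n_edges G x y) * cmod (f x)))"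
      by (rule sum.cong) (simp_all flip: mult.assoc)
    finally have "(cmod (adj G f y))\<^sup>2
        \<le> (\<Sum>x\<in>N y. sqrt (n_edges G x y) * (sqrt (n_edges G x y) * cmod (f x)))\<^sup>2"
      by (rule power_mono) simp
    also have "\<dots> \<le> (\<Sum>x\<in>N y. (sqrt (n_edges G x y))\<^sup>2)
        * (\<Sum>x\<in>N y. (sqrt (n_edges G x y) * cmod (f x))\<^sup>2)"
      by (rule Cauchy_Schwarz_ineq_sum)
    also have "\<dots> = real (\<Sum>x\<in>N y. n_edges G y x) * (\<Sum>x\<in>N y. real (n_edges G x y) * (cmod (f x))\<^sup>2)"
      by (simp add: power_mult_distrib n_edges_commute[of G y])
    also have "\<dots> \<le> real d * (\<Sum>x\<in>N y. real (n_edges G x y) * (cmod (f x))\<^sup>2)"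
      using sum_n_edges_le[OF G finN, of y y]
      by (intro mult_right_mono of_nat_mono sum_nonneg) auto
    finally show ?thesis .
  qed
  have bd: "(\<Sum>y\<in>F. (cmod (adj G f y))\<^sup>2) \<le> (real d)\<^sup>2 * (\<Sum>\<^sub>\<infinity>x. (cmod (f x))\<^sup>2)"
    if F: "finite F" for F
  proof -
    define M where "M = (\<Union>y\<in>F. N y)"
    have M: "finite M" using F finN by (simp add: M_def)
    have "(\<Sum>y\<in>F. (cmod (adj G f y))\<^sup>2)
        \<le> (\<Sum>y\<in>F. real d * (\<Sum>x\<in>M. real (n_edges G x y) * (cmod (f x))\<^sup>2))"
    proof (rule sum_mono)
      fix y assume "y \<in> F"
      then have "(\<Sum>x\<in>N y. real (n_edges G x y) * (cmod (f x))\<^sup>2)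
          \<le> (\<Sum>x\<in>M. real (n_edges G x y) * (cmod (f x))\<^sup>2)"
        using M by (intro sum_mono2) (auto simp: M_def)
      then show "(cmod (adj G f y))\<^sup>2 \<le> real d * (\<Sum>x\<in>M. real (n_edges G x y) * (cmod (f x))\<^sup>2)"
        using pt[of y] by (meson mult_left_mono of_nat_0_le_iff order_trans)
    qed
    also have "\<dots> = real d * (\<Sum>x\<in>M. real (\<Sum>y\<in>F. n_edges G x y) * (cmod (f x))\<^sup>2)"
      by (simp add: sum_distrib_left sum_distrib_right sum.swap[of _ M F])
    also have "\<dots> \<le> real d * (\<Sum>x\<in>M. real d * (cmod (f x))\<^sup>2)"
      using sum_n_edges_le[OF G F]
      by (intro mult_left_mono sum_mono mult_right_mono of_nat_mono) auto
    also have "\<dots> = (real d)\<^sup>2 * (\<Sum>x\<in>M. (cmod (f x))\<^sup>2)"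
      by (simp add: sum_distrib_left power2_eq_square mult.assoc)
    also have "\<dots> \<le> (real d)\<^sup>2 * (\<Sum>\<^sub>\<infinity>x. (cmod (f x))\<^sup>2)"
      by (intro mult_left_mono finite_sum_le_infsum sf M) auto
    finally show ?thesis .
  qed
  have sA: "(\<lambda>x. (cmod (adj G f x))\<^sup>2) summable_on UNIV"
    by (rule nonneg_bdd_above_summable_on) (use bd in \<open>auto simp: bdd_above_def\<close>)
  have "adj G f y = 0" if "y \<notin> verts G" for y
  proof -
    have "n_edges G x y = 0" for x
      using that n_edges_outside[OF G(1)] by blast
    then show ?thesis by (simp add: adj_def)
  qed
  then show "adj G f \<in> ell2 (verts G)" using sA by (simp add: ell2_def)
  show "(\<Sum>\<^sub>\<infinity>x. (cmod (adj G f x))\<^sup>2) \<le> (real d)\<^sup>2 * (\<Sum>\<^sub>\<infinity>x. (cmod (f x))\<^sup>2)"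
    by (rule infsum_le_finite_sums[OF sA]) (rule bd)
qed

lemma multigraph_orth_loop_product:
  assumes "rooted_graph G1" "rooted_graph G2"
  shows "multigraph (orth_loop_product G1 G2)"
proof -
  have ends1: "\<exists>x\<in>verts G1. \<exists>y\<in>verts G1. ends G1 b = {x, y}" if "b \<in> edges G1" for b
    using assms(1) that by (auto simp: rooted_graph_def multigraph_def)
  have ends2: "\<exists>x\<in>verts G2. \<exists>y\<in>verts G2. ends G2 b = {x, y}" if "b \<in> edges G2" for b
    using assms(2) that by (auto simp: rooted_graph_def multigraph_def)
  have r: "base G1 \<in> verts G1" "base G2 \<in> verts G2"
    using assms by (auto simp: rooted_graph_def)
  let ?V = "verts (orth_product G1 G2)"
  show ?thesis
    unfolding multigraph_def
  proof
    fix b assume b: "b \<in> edges (orth_loop_product G1 G2)"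
    consider b1 where "b = Edge (Inl b1)" "b1 \<in> edges G1"
      | x b2 where "b = Edge (Inr (x, b2))" "x \<in> verts G1 - {base G1}" "b2 \<in> edges G2"
      | i v where "b = Loop i v" "v \<in> ?V"
      using b r by (auto simp: orth_loop_product_def attach_loops_def orth_product_def)
    then show "\<exists>x\<in>verts (orth_loop_product G1 G2). \<exists>y\<in>verts (orth_loop_product G1 G2).
        ends (orth_loop_product G1 G2) b = {x, y}"
    proof cases
      case (1 b1)
      then obtain x y where "x \<in> verts G1" "y \<in> verts G1" "ends G1 b1 = {x, y}"
        using ends1[OF 1(2)] by blast
      then show ?thesis using 1 r
        apply -
        apply (rule bexI[of _ "(x, base G2)"], rule bexI[of _ "(y, base G2)"])
        by (auto simp: orth_loop_product_def attach_loops_def orth_product_def)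
    next
      case (2 u b2)
      then obtain x y where "x \<in> verts G2" "y \<in> verts G2" "ends G2 b2 = {x, y}"
        using ends2[OF 2(3)] by blast
      then show ?thesis using 2
        apply -
        apply (rule bexI[of _ "(u, x)"], rule bexI[of _ "(u, y)"])
        by (auto simp: orth_loop_product_def attach_loops_def orth_product_def)
    next
      case (3 i v)
      then show ?thesis
        apply -
        apply (rule bexI[of _ v], rule bexI[of _ v])
        by (auto simp: orth_loop_product_def attach_loops_def)
    qed
  qed
qed

lemma degree_bound_orth_loop_product:
  fixes G1 :: "('a, 'b) rgraph" and G2 :: "('c, 'd) rgraph"
  assumes "rooted_graph G1" "rooted_graph G2"
  shows "\<exists>d. degree_bound (orth_loop_product G1 G2) d"
proof -
  obtain d1 d2 where d: "degree_bound G1 d1" "degree_bound G2 d2"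
    using assms by (auto simp: rooted_graph_def)
  let ?G = "orth_loop_product G1 G2"
  have "finite {b\<in>edges ?G. v \<in> ends ?G b} \<and> card {b\<in>edges ?G. v \<in> ends ?G b} \<le> d1 + d2 + 2"
    if v: "v \<in> verts ?G" for v
  proof -
    obtain x y where xy: "v = (x, y)" "x \<in> verts G1" "y \<in> verts G2"
      using v by (auto simp: orth_loop_product_def attach_loops_def orth_product_def)
    define E1 where "E1 = {b\<in>edges G1. x \<in> ends G1 b}"
    define E2 where "E2 = {b\<in>edges G2. y \<in> ends G2 b}"
    have E: "finite E1" "card E1 \<le> d1" "finite E2" "card E2 \<le> d2"
      using d xy by (auto simp: degree_bound_def E1_def E2_def)
    define S1 where "S1 = ((\<lambda>b. Edge (Inl b)) ` E1 :: ('a \<times> 'c, 'b + 'a \<times> 'd) with_loops set)"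
    define S2 where "S2 = ((\<lambda>b. Edge (Inr (x, b))) ` E2 :: ('a \<times> 'c, 'b + 'a \<times> 'd) with_loops set)"
    define S3 where "S3 = {Loop 1 v, Loop 2 v :: ('a \<times> 'c, 'b + 'a \<times> 'd) with_loops}"
    have sub: "{b\<in>edges ?G. v \<in> ends ?G b} \<subseteq> S1 \<union> S2 \<union> S3"
      by (auto simp: orth_loop_product_def attach_loops_def orth_product_def xy
          E1_def E2_def S1_def S2_def S3_def)
    have fin: "finite (S1 \<union> S2 \<union> S3)" using E by (simp add: S1_def S2_def S3_def)
    have "card S1 \<le> d1"
      using card_image_le[OF E(1)] E(2) unfolding S1_def by (rule order_trans)
    moreover have "card S2 \<le> d2"
      using card_image_le[OF E(3)] E(4) unfolding S2_def by (rule order_trans)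
    moreover have "card S3 \<le> 2" by (simp add: S3_def)
    ultimately have "card (S1 \<union> S2 \<union> S3) \<le> d1 + d2 + 2"
      using card_Un_le[of "S1 \<union> S2" S3] card_Un_le[of S1 S2] by linarith
    then show ?thesis using sub fin by (meson card_mono finite_subset order_trans)
  qed
  then show ?thesis unfolding degree_bound_def by blast
qed

lemma color_subgraph_multigraph:
  "multigraph G \<Longrightarrow> multigraph (color_subgraph G i)"
  by (simp add: multigraph_def color_subgraph_def)

lemma color_subgraph_degree_bound:
  assumes "degree_bound G d"
  shows "degree_bound (color_subgraph G i) d"
  unfolding degree_bound_def
proof
  fix x assume "x \<in> verts (color_subgraph G i)"
  then have x: "finite {b\<in>edges G. x \<in> ends G b}" "card {b\<in>edges G. x \<in> ends G b} \<le> d"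
    using assms by (auto simp: degree_bound_def color_subgraph_def)
  have "{b\<in>edges (color_subgraph G i). x \<in> ends (color_subgraph G i) b}
      \<subseteq> {b\<in>edges G. x \<in> ends G b}"
    by (auto simp: color_subgraph_def)
  then show "finite {b\<in>edges (color_subgraph G i). x \<in> ends (color_subgraph G i) b} \<and>
      card {b\<in>edges (color_subgraph G i). x \<in> ends (color_subgraph G i) b} \<le> d"
    using x by (meson card_mono finite_subset order_trans)
qed

lemma adj_decomposition:
  assumes "rooted_graph G1" "rooted_graph G2" and G: "G = orth_loop_product G1 G2"
  shows "adj G f y = color_adj G 1 f y + color_adj G 2 f y"
proof -
  obtain d where d: "degree_bound G d" using degree_bound_orth_loop_product[OF assms(1,2)] G by auto
  have m: "multigraph G" using multigraph_orth_loop_product[OF assms(1,2)] G by simp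
  have col: "color G b = 1 \<or> color G b = 2" if "b \<in> edges G" for b
    using that G by (auto simp: orth_loop_product_def attach_loops_def orth_product_def)
  have n: "n_edges G x y = n_edges (color_subgraph G 1) x y + n_edges (color_subgraph G 2) x y" for x
  proof -
    have "{b. joins G b x y} = {b. joins (color_subgraph G 1) b x y} \<union> {b. joins (color_subgraph G 2) b x y}"
      using col by (auto simp: joins_def color_subgraph_def)
    moreover have "{b. joins (color_subgraph G 1) b x y} \<inter> {b. joins (color_subgraph G 2) b x y} = {}"
      by (auto simp: joins_def color_subgraph_def)
    moreover have "finite {b. joins (color_subgraph G i) b x y}" for i
      by (rule finite_joins[OF color_subgraph_multigraph[OF m] color_subgraph_degree_bound[OF d]])
    ultimately show ?thesis by (simp add: n_edges_def card_Un_disjoint)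
  qed
  let ?N = "{x \<in> verts G. n_edges G x y \<noteq> 0}"
  have fin: "finite ?N"
    using finite_neighbours[OF m d, of y] by (simp add: n_edges_commute[of G _ y])
  have "color_adj G i f y = (\<Sum>x\<in>?N. of_nat (n_edges (color_subgraph G i) x y) * f x)"
    if "i = 1 \<or> i = 2" for i
    unfolding color_adj_def adj_def
    by (rule sum.mono_neutral_left[OF fin]) (use that n in \<open>auto simp: color_subgraph_def\<close>)
  then show ?thesis
    by (simp add: adj_def n sum.distrib distrib_right)
qed

end

theory Submission
  imports Defs
begin

text \<open>
  The coefficients of \<open>\<eta>\<close> of an operator \<open>T\<close> in the state of \<open>\<delta>(e)\<close> are first-return amplitudes
  \<open>\<langle>T (Q T)\<^sup>n \<delta>(e), \<delta>(e)\<rangle>\<close>, where \<open>Q\<close> kills the value at \<open>e\<close>. For \<open>Z = R\<^sub>2 R\<^sub>1\<close> they count the alternating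
  d-walks, because color \<open>2\<close> meets the root only in its loop, so that the second f-walk of such a
  d-walk is this loop. The power series vector \<open>U = \<Sum>\<^sub>n z\<^sup>n (Q Z)\<^sup>n \<delta>(e)\<close> solves \<open>U = \<delta>(e) + z Q Z U\<close>.
  On a copy of \<open>\<G>\<^sub>2\<close> this is a first-return equation for \<open>A(\<G>\<^sub>2)\<close> in the variable \<open>z\<close>;
  eliminating the copies leaves \<open>W = \<delta>(e\<^sub>1) + \<eta>\<^sub>2(z) Q A(\<G>\<^sub>1) W\<close> on \<open>\<G>\<^sub>1\<close>, hence the amplitude series of
  \<open>Z\<close> is \<open>\<rho>\<^sub>1(\<eta>\<^sub>2(z))\<close>.

  For orthogonality, \<open>R\<^sub>1 - 1\<close> factors through restriction to the copy of \<open>V\<^sub>1\<close>, and an element \<open>b'\<close>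
  of the algebra of \<open>R\<^sub>2 - 1\<close> compressed to that copy is a scalar off the root and \<open>0\<close> at the root.
\<close>

section \<open>Kernel operators and first returns\<close>

text \<open>Over formal power series as well as over \<open>\<complex>\<close>; infinite columns of \<open>M\<close> give the junk value \<open>0\<close>.\<close>

definition kernel_op :: "('v \<Rightarrow> 'v \<Rightarrow> nat) \<Rightarrow> ('v \<Rightarrow> 'a) \<Rightarrow> 'v \<Rightarrow> 'a::comm_ring_1" where
  "kernel_op M f = (\<lambda>y. \<Sum>x | M x y \<noteq> 0. of_nat (M x y) * f x)"

definition lin_oper :: "(('v \<Rightarrow> 'a) \<Rightarrow> 'v \<Rightarrow> 'a::comm_ring_1) \<Rightarrow> bool" where
  "lin_oper T \<longleftrightarrow> (\<forall>c f g. T (\<lambda>x. c * f x + g x) = (\<lambda>x. c * T f x + T g x))"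

definition avoid :: "'v \<Rightarrow> (('v \<Rightarrow> 'a) \<Rightarrow> 'v \<Rightarrow> 'a) \<Rightarrow> ('v \<Rightarrow> 'a) \<Rightarrow> 'v \<Rightarrow> 'a::zero" where
  "avoid e T f = (\<lambda>x. if x = e then 0 else T f x)"

definition return_coeff :: "'v \<Rightarrow> 'v oper \<Rightarrow> nat \<Rightarrow> complex" where
  "return_coeff e T n = T ((avoid e T ^^ n) (delta e)) e"

section \<open>Linear operators, and kernels over power series\<close>

lemma lin_operD: "lin_oper T \<Longrightarrow> T (\<lambda>x. c * f x + g x) = (\<lambda>x. c * T f x + T g x)"
  by (simp add: lin_oper_def)

lemma lin_oper_add: "lin_oper T \<Longrightarrow> T (\<lambda>x. f x + g x) = (\<lambda>x. T f x + T g x)"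
  using lin_operD[of T 1 f g] by simp

lemma lin_oper_zero: "lin_oper T \<Longrightarrow> T (\<lambda>x. 0) = (\<lambda>x. 0)"
  using lin_oper_add[of T "\<lambda>x. 0" "\<lambda>x. 0"] by (simp add: fun_eq_iff)

lemma lin_oper_scale: "lin_oper T \<Longrightarrow> T (\<lambda>x. c * f x) = (\<lambda>x. c * T f x)"
  using lin_operD[of T c f "\<lambda>x. 0"] by (simp add: lin_oper_zero)

lemma lin_oper_sum:
  assumes "lin_oper T"
  shows "T (\<lambda>x. \<Sum>i\<in>I. c i * f i x) = (\<lambda>x. \<Sum>i\<in>I. c i * T (f i) x)"
  by (induction I rule: infinite_finite_induct)
     (simp_all add: lin_oper_zero[OF assms] lin_oper_add[OF assms] lin_oper_scale[OF assms])

lemma lin_operI: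
  assumes "\<And>c f g. T (\<lambda>x. c * f x + g x) = (\<lambda>x. c * T f x + T g x)"
  shows "lin_oper T"
  using assms by (simp add: lin_oper_def)

lemma lin_oper_kernel_op: "lin_oper (kernel_op M)"
  by (rule lin_operI)
     (simp add: kernel_op_def distrib_left sum.distrib sum_distrib_left mult.left_commute)

lemma lin_oper_comp: "lin_oper T \<Longrightarrow> lin_oper U \<Longrightarrow> lin_oper (T \<circ> U)"
  by (simp add: lin_oper_def)

lemma lin_oper_minus_id: "lin_oper T \<Longrightarrow> lin_oper (T - id)"
  by (simp add: lin_oper_def fun_eq_iff algebra_simps)

text \<open>Multiplicities are constant power series, so the operator acts on each coefficient
  separately; one power series vector can then stand for a sequence of complex vectors.\<close>

lemma kernel_op_fps_nth: "fps_nth (kernel_op M f y) n = kernel_op M (\<lambda>x. fps_nth (f x) n) y"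
proof -
  have "fps_nth (of_nat k * g) n = of_nat k * fps_nth g n" for k and g :: "'a fps"
    using fps_mult_left_const_nth[of "of_nat k" g n] by (simp only: fps_of_nat)
  then show ?thesis by (simp only: kernel_op_def fps_sum_nth)
qed

lemma kernel_op_fps_const: "kernel_op M (\<lambda>x. fps_const (f x)) y = fps_const (kernel_op M f y)"
proof (rule fps_ext)
  fix n
  show "fps_nth (kernel_op M (\<lambda>x. fps_const (f x)) y) n = fps_nth (fps_const (kernel_op M f y)) n"
    unfolding kernel_op_fps_nth by (cases "n = 0") (simp_all add: kernel_op_def)
qed

lemma adj_eq_kernel_op:
  assumes "multigraph G"
  shows "adj G = kernel_op (n_edges G)"
proof (intro ext)
  fix f y
  have "n_edges G x y \<noteq> 0 \<Longrightarrow> x \<in> verts G" for x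
    using n_edges_outside[OF assms, of x y] by (cases "x \<in> verts G") simp_all
  then have "{x. x \<in> verts G \<and> n_edges G x y \<noteq> 0} = {x. n_edges G x y \<noteq> 0}"
    by auto
  then show "adj G f y = kernel_op (n_edges G) f y"
    by (simp add: adj_def kernel_op_def)
qed

lemma kernel_op_outside:
  assumes "multigraph G" "y \<notin> verts G"
  shows "kernel_op (n_edges G) f y = 0"
proof -
  have "n_edges G x y = 0" for x using n_edges_outside[of G x y] assms by simp
  then show ?thesis by (simp add: kernel_op_def)
qed

section \<open>Moments and first returns\<close>

lemma vec_state_delta: "vec_state (delta e) T = T (delta e) e"
proof -
  have "ell2_inner (T (delta e)) (delta e) = (\<Sum>\<^sub>\<infinity>x\<in>{e}. T (delta e) x * cnj (delta e x))"
    unfolding ell2_inner_def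
    by (rule infsum_cong_neutral) (auto simp: delta_def)
  then show ?thesis by (simp add: vec_state_def delta_def)
qed

lemma distribution_monom:
  "distribution (vec_state (delta e)) T (monom 1 n) = (T ^^ n) (delta e) e"
  by (simp add: distribution_def vec_state_delta degree_monom_eq if_distrib[of "\<lambda>c. c * _"]
      cong: if_cong)

text \<open>The steps are sorted by the time \<open>k + 1\<close> of the first return to
  \<open>e\<close>, after which \<open>n - 1 - k\<close> unrestricted steps remain; the first
  summand never returns.\<close>

lemma power_first_return:
  assumes "lin_oper T"
  shows "(T ^^ n) (delta e) = (\<lambda>x. (avoid e T ^^ n) (delta e) x
    + (\<Sum>k<n. return_coeff e T k * (T ^^ (n - 1 - k)) (delta e) x))"
proof (induction n)
  case 0
  then show ?case by simp
next
  case (Suc n)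
  \<comment> \<open>Splitting off the value at \<open>e\<close> turns one more application of
    \<open>T\<close> into the next avoiding power plus a new return term.\<close>
  have split: "T f = (\<lambda>x. avoid e T f x + T f e * delta e x)" for f
    by (auto simp: avoid_def delta_def)
  have pw: "T ((T ^^ (n - Suc k)) (delta e)) = (T ^^ (n - k)) (delta e)" if "k < n" for k
  proof -
    have "n - k = Suc (n - Suc k)" using that by simp
    then show ?thesis by simp
  qed
  have "(T ^^ Suc n) (delta e) = T (\<lambda>x. (avoid e T ^^ n) (delta e) x
    + (\<Sum>k<n. return_coeff e T k * (T ^^ (n - 1 - k)) (delta e) x))"
    by (simp only: Suc.IH[symmetric] funpow.simps comp_apply)
  also have "\<dots> = (\<lambda>x. T ((avoid e T ^^ n) (delta e)) x
    + (\<Sum>k<n. return_coeff e T k * T ((T ^^ (n - 1 - k)) (delta e)) x))"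
    by (simp only: lin_oper_add[OF assms] lin_oper_sum[OF assms])
  also have "\<dots> = (\<lambda>x. avoid e T ((avoid e T ^^ n) (delta e)) x + return_coeff e T n * delta e x
    + (\<Sum>k<n. return_coeff e T k * (T ^^ (n - k)) (delta e) x))"
  proof -
    have "(\<Sum>k<n. return_coeff e T k * T ((T ^^ (n - 1 - k)) (delta e)) x)
        = (\<Sum>k<n. return_coeff e T k * (T ^^ (n - k)) (delta e) x)" for x
      by (rule sum.cong) (simp_all add: pw)
    then show ?thesis by (subst split) (simp add: return_coeff_def add_ac)
  qed
  finally show ?case by (simp add: add_ac)
qed

text \<open>Avoiding powers of positive order vanish at \<open>e\<close>, so the first-return
  decomposition becomes the renewal equation \<psi> = z r (1 + \<psi>). The factor
  \<open>fps_X\<close> is there because \<open>return_coeff e T n\<close> uses \<open>n + 1\<close>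
  applications of \<open>T\<close>.\<close>

lemma eta_series_first_return:
  assumes "lin_oper T"
  shows "eta_series (distribution (vec_state (delta e)) T) = fps_X * Abs_fps (return_coeff e T)"
proof -
  let ?\<psi> = "psi_series (distribution (vec_state (delta e)) T)"
  let ?r = "Abs_fps (return_coeff e T)"
  define m where "m = (\<lambda>n. (T ^^ n) (delta e) e)"
  have \<psi>1: "1 + ?\<psi> = Abs_fps m"
    by (rule fps_ext) (simp add: psi_series_def distribution_monom m_def, simp add: delta_def)
  have "?\<psi> = fps_X * ?r * (1 + ?\<psi>)"
  proof (rule fps_ext)
    fix n
    show "fps_nth ?\<psi> n = fps_nth (fps_X * ?r * (1 + ?\<psi>)) n"
    proof (cases n)
      case 0
      then show ?thesis by (simp add: psi_series_def)
    next
      case (Suc j)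
      have "fps_nth ?\<psi> (Suc j) = m (Suc j)" by (simp add: psi_series_def distribution_monom m_def)
      also have "\<dots> = (\<Sum>k<Suc j. return_coeff e T k * m (j - k))"
        unfolding m_def
        by (subst power_first_return[OF assms]) (simp add: avoid_def)
      also have "\<dots> = fps_nth (?r * Abs_fps m) j"
        by (simp add: fps_mult_nth lessThan_Suc_atMost atLeast0AtMost)
      finally show ?thesis by (simp add: \<psi>1 Suc mult.assoc)
    qed
  qed
  moreover have "fps_nth (1 + ?\<psi>) 0 \<noteq> 0" by (simp add: psi_series_def)
  ultimately show ?thesis
    unfolding eta_series_def
    by (metis fps_divide_times_eq fps_nonzero_nth nonzero_mult_div_cancel_right)
qed

text \<open>With T the kernel operator, W = W(e) \<delta>(e) + s Q T W, and iterating gives a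
  Neumann series in \<open>s\<close>. \<open>W e\<close> is left arbitrary because on a copy of the
  second graph the value at its root is still unknown.\<close>

lemma kernel_op_resolvent:
  fixes W :: "'v \<Rightarrow> complex fps"
  assumes s: "fps_nth s 0 = 0"
    and W: "\<And>x. x \<noteq> e \<Longrightarrow> W x = s * kernel_op M W x"
  shows "kernel_op M W e = W e * (Abs_fps (return_coeff e (kernel_op M)) oo s)"
proof (rule fps_ext)
  fix n
  define b where "b = (\<lambda>k. (avoid e (kernel_op M) ^^ k) (delta e))"
  let ?r = "return_coeff e (kernel_op M)"
  have T: "kernel_op M (\<lambda>x. (\<Sum>k<N. W e * s ^ k * fps_const (b k x)) + s ^ N * R x)
      = (\<lambda>x. (\<Sum>k<N. W e * s ^ k * fps_const (kernel_op M (b k) x)) + s ^ N * kernel_op M R x)"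
    for N R
    by (simp only: lin_oper_add[OF lin_oper_kernel_op] lin_oper_sum[OF lin_oper_kernel_op]
        lin_oper_scale[OF lin_oper_kernel_op] kernel_op_fps_const)
  \<comment> \<open>An exact finite expansion replaces the infinite series; each round turns the
    remainder \<open>R\<close> into \<open>avoid e (kernel_op M) R\<close>.\<close>
  have "\<exists>R. W = (\<lambda>x. (\<Sum>k<N. W e * s ^ k * fps_const (b k x)) + s ^ N * R x)" for N
  proof (induction N)
    case 0
    show ?case by (rule exI[of _ W]) simp
  next
    case (Suc N)
    then obtain R where
      R: "W = (\<lambda>x. (\<Sum>k<N. W e * s ^ k * fps_const (b k x)) + s ^ N * R x)" by blast
    have TW: "kernel_op M W = (\<lambda>x. (\<Sum>k<N. W e * s ^ k * fps_const (kernel_op M (b k) x))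
        + s ^ N * kernel_op M R x)"
      using T[of N R] R by metis
    show ?case
    proof (intro exI ext)
      fix x
      show "W x = (\<Sum>k<Suc N. W e * s ^ k * fps_const (b k x))
          + s ^ Suc N * avoid e (kernel_op M) R x"
      proof (cases "x = e")
        case True
        then show ?thesis
          unfolding sum.lessThan_Suc_shift by (simp add: b_def delta_def avoid_def)
      next
        case False
        have "W x = s * kernel_op M W x" by (rule W[OF False])
        also have "\<dots> = (\<Sum>k<N. W e * s ^ Suc k * fps_const (b (Suc k) x))
            + s ^ Suc N * avoid e (kernel_op M) R x"
          using False unfolding TW
          by (simp add: b_def avoid_def distrib_left sum_distrib_left mult_ac)
        finally show ?thesis
          using False unfolding sum.lessThan_Suc_shift by (simp add: b_def delta_def)
      qed
    qed
  qed
  \<comment> \<open>With \<open>Suc n\<close> terms the remainder carries \<open>s ^ Suc n\<close>,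
    which has no coefficient of order at most \<open>n\<close>.\<close>
  then obtain R where
    R: "W = (\<lambda>x. (\<Sum>k<Suc n. W e * s ^ k * fps_const (b k x)) + s ^ Suc n * R x)" by blast
  define D where "D = (\<Sum>k<Suc n. fps_const (?r k) * s ^ k)"
  have "kernel_op M W e = W e * D + s ^ Suc n * kernel_op M R e"
    by (subst R, subst T) (simp add: D_def b_def return_coeff_def sum_distrib_left mult_ac
        del: sum.lessThan_Suc)
  moreover have "fps_nth (s ^ Suc n * kernel_op M R e) n = 0"
    by (simp add: fps_mult_nth startsby_zero_power_prefix[OF s] del: power_Suc)
  ultimately have "fps_nth (kernel_op M W e) n = fps_nth (W e * D) n" by simp
  also have "\<dots> = fps_nth (W e * (Abs_fps ?r oo s)) n"
  proof -
    have "fps_nth D j = fps_nth (Abs_fps ?r oo s) j" if "j \<le> n" for j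
    proof -
      have "fps_nth D j = (\<Sum>k<Suc n. ?r k * fps_nth (s ^ k) j)"
        by (simp add: D_def fps_sum_nth del: sum.lessThan_Suc)
      also have "\<dots> = (\<Sum>k=0..j. ?r k * fps_nth (s ^ k) j)"
        using that startsby_zero_power_prefix[OF s]
        by (intro sum.mono_neutral_right) auto
      finally show ?thesis by (simp add: fps_compose_nth)
    qed
    then show ?thesis by (simp add: fps_mult_nth)
  qed
  finally show "fps_nth (kernel_op M W e) n = fps_nth (W e * (Abs_fps ?r oo s)) n" .
qed

section \<open>Linearity and support in generated algebras\<close>

lemma lin_oper_gen_alg:
  assumes "T \<in> gen_alg S" "\<And>T. T \<in> S \<Longrightarrow> lin_oper T"
  shows "lin_oper T"
  using assms(1)
proof induction
  case (comp T U)
  show ?case by (rule lin_oper_comp[OF comp.IH])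
qed (simp_all add: assms(2), simp_all add: lin_oper_def algebra_simps)

text \<open>Operators act on all functions, and off the vertex set an adjacency operator gives 0
  while the identity does not; the formulas for \<open>R1 - id\<close> and \<open>R2 - id\<close>
  are therefore stated for functions vanishing there.\<close>

definition supported :: "'v set \<Rightarrow> ('v \<Rightarrow> complex) \<Rightarrow> bool" where
  "supported V f \<longleftrightarrow> (\<forall>v. v \<notin> V \<longrightarrow> f v = 0)"

lemma supported_gen_alg:
  assumes "T \<in> gen_alg S" "\<And>T f. T \<in> S \<Longrightarrow> supported V f \<Longrightarrow> supported V (T f)" "supported V f"
  shows "supported V (T f)"
  using assms(1,3)
  by (induction arbitrary: f) (simp_all add: assms(2), simp_all add: supported_def)

section \<open>Counting paths\<close>

text \<open>The graph and the admissible vertices depend on time: the combinatorial form of a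
  product of different operators with projections in between. The mask \<open>C\<close> is imposed
  at times below \<open>n\<close>, not on the final vertex.\<close>

definition path_set ::
  "(nat \<Rightarrow> ('v, 'e, 'z) rgraph_scheme) \<Rightarrow> (nat \<Rightarrow> 'v set) \<Rightarrow> 'v \<Rightarrow> nat \<Rightarrow> 'v \<Rightarrow> ('v, 'e) walk set"
where
  "path_set H C e n y = {(vs, bs). length bs = n \<and> length vs = Suc n \<and> vs ! 0 = e \<and> vs ! n = y \<and>
     (\<forall>i<n. vs ! i \<in> C i \<and> joins (H i) (bs ! i) (vs ! i) (vs ! Suc i))}"

lemma path_set_0: "path_set H C e 0 y = (if y = e then {([e], [])} else {})"
  by (auto simp: path_set_def length_Suc_conv)

lemma path_set_Suc:
  assumes fin: "\<And>x. finite {b. joins (H n) b x y}"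
  shows "path_set H C e (Suc n) y = (\<lambda>(x, (vs, bs), b). (vs @ [y], bs @ [b])) `
    (SIGMA x:{x \<in> C n. n_edges (H n) x y \<noteq> 0}. path_set H C e n x \<times> {b. joins (H n) b x y})"
    (is "?L = ?f ` ?S")
proof (intro equalityI subsetI)
  fix w assume "w \<in> ?L"
  then obtain vs bs where w: "w = (vs, bs)" and l: "length bs = Suc n" "length vs = Suc (Suc n)"
    and v: "vs ! 0 = e" "vs ! Suc n = y"
    and j: "\<And>i. i < Suc n \<Longrightarrow> vs ! i \<in> C i \<and> joins (H i) (bs ! i) (vs ! i) (vs ! Suc i)"
    unfolding path_set_def by blast
  have vs: "vs = butlast vs @ [y]" and bs: "bs = butlast bs @ [bs ! n]"
    using l v by (metis append_butlast_last_id diff_Suc_1 last_conv_nth length_0_conv nat.simps(3))+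
  \<comment> \<open>Finiteness matters: an infinite edge set would have cardinality 0.\<close>
  have "n_edges (H n) (vs ! n) y \<noteq> 0"
    using j[of n] v fin by (auto simp: n_edges_def)
  moreover have "(butlast vs, butlast bs) \<in> path_set H C e n (vs ! n)"
    using l v j by (auto simp: path_set_def nth_butlast)
  ultimately have "(vs ! n, (butlast vs, butlast bs), bs ! n) \<in> ?S"
    using j[of n] v by auto
  then show "w \<in> ?f ` ?S" by (rule rev_image_eqI) (use w vs bs in simp)
next
  fix w assume "w \<in> ?f ` ?S"
  then obtain x vs bs b where "w = (vs @ [y], bs @ [b])" "(vs, bs) \<in> path_set H C e n x"
    "joins (H n) b x y" "x \<in> C n" by auto
  then show "w \<in> ?L"
    by (auto simp: path_set_def nth_append less_Suc_eq)
qed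

text \<open>Appending a last edge is injective, so one more step of a path is one application of the
  kernel operator to the masked counts.\<close>

lemma card_path_set:
  assumes fin: "\<And>i x y. finite {b. joins (H i) b x y}" "\<And>i y. finite {x. n_edges (H i) x y \<noteq> 0}"
  shows "finite (path_set H C e n y)"
    and "of_nat (card (path_set H C e (Suc n) y)) = kernel_op (n_edges (H n))
      (\<lambda>x. if x \<in> C n then of_nat (card (path_set H C e n x)) else 0) y"
proof -
  have finS: "finite (SIGMA x:{x \<in> C n. n_edges (H n) x y \<noteq> 0}.
      path_set H C e n x \<times> {b. joins (H n) b x y})"
    if "\<And>x. finite (path_set H C e n x)" for n y
    using that fin(1) by (intro finite_SigmaI finite_subset[OF _ fin(2)[of n y]]) auto
  have finP: "finite (path_set H C e n y)" for n y
  proof (induction n arbitrary: y)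
    case (Suc n)
    show ?case unfolding path_set_Suc[OF fin(1)] by (rule finite_imageI, rule finS, rule Suc.IH)
  qed (simp add: path_set_0)
  then show "finite (path_set H C e n y)" .
  let ?S = "{x \<in> C n. n_edges (H n) x y \<noteq> 0}"
  have "inj_on (\<lambda>(x, (vs, bs), b). (vs @ [y], bs @ [b]))
      (SIGMA x:?S. path_set H C e n x \<times> {b. joins (H n) b x y})"
    by (auto simp: inj_on_def path_set_def)
  then have "card (path_set H C e (Suc n) y)
      = card (SIGMA x:?S. path_set H C e n x \<times> {b. joins (H n) b x y})"
    unfolding path_set_Suc[OF fin(1)] by (rule card_image)
  also have "\<dots> = (\<Sum>x\<in>?S. card (path_set H C e n x) * n_edges (H n) x y)"
    using finite_subset[OF _ fin(2)[of n y], of ?S] finP fin(1)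
    by (subst card_SigmaI) (auto simp: card_cartesian_product n_edges_def)
  also have "of_nat \<dots> = kernel_op (n_edges (H n))
      (\<lambda>x. if x \<in> C n then of_nat (card (path_set H C e n x)) else 0) y"
    unfolding kernel_op_def of_nat_sum of_nat_mult
    by (rule sum.mono_neutral_cong_left[OF fin(2)]) (auto simp: mult.commute)
  finally show "of_nat (card (path_set H C e (Suc n) y)) = kernel_op (n_edges (H n))
      (\<lambda>x. if x \<in> C n then of_nat (card (path_set H C e n x)) else 0) y" .
qed

section \<open>The two colors of the orthogonal loop product\<close>

locale orth_loop =
  fixes G1 :: "('v1, 'e1) rgraph" and G2 :: "('v2, 'e2) rgraph"
  assumes rooted1: "rooted_graph G1" and rooted2: "rooted_graph G2"
begin

abbreviation "e1 \<equiv> base G1"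
abbreviation "e2 \<equiv> base G2"
abbreviation "P \<equiv> orth_loop_product G1 G2"
abbreviation "V \<equiv> {(x, y). x \<in> verts G1 \<and> y \<in> verts G2 \<and> (x = e1 \<longrightarrow> y = e2)}"
abbreviation "K1 \<equiv> n_edges G1"
abbreviation "K2 \<equiv> n_edges G2"
abbreviation "C1 \<equiv> n_edges (color_subgraph P (Suc 0))"
abbreviation "C2 \<equiv> n_edges (color_subgraph P 2)"

lemmas product_defs = orth_loop_product_def attach_loops_def orth_product_def color_subgraph_def

lemma base_in: "e1 \<in> verts G1" "e2 \<in> verts G2"
  and multi: "multigraph G1" "multigraph G2"
  using rooted1 rooted2 by (simp_all add: rooted_graph_def)

lemma verts_P: "verts P = V" "verts (color_subgraph P i) = V" and base_P: "base P = (e1, e2)"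
  by (simp_all add: product_defs)

lemma multi_P: "multigraph P" "multigraph (color_subgraph P i)"
  using multigraph_orth_loop_product[OF rooted1 rooted2] color_subgraph_multigraph by blast+

lemma finite_joins_P: "finite {b. joins (color_subgraph P i) b u v}"
proof -
  obtain d where "degree_bound P d"
    using degree_bound_orth_loop_product[OF rooted1 rooted2] by blast
  then show ?thesis
    by (rule finite_joins[OF multi_P(2) color_subgraph_degree_bound])
qed

section \<open>Edges of the two colors in coordinates\<close>

lemma image_Pair_root_iff: "(\<lambda>x. (x, c)) ` S = {(x, c), (x', c)} \<longleftrightarrow> S = {x, x'}"
proof -
  have "(\<lambda>x. (x, c)) ` S = (\<lambda>x. (x, c)) ` {x, x'} \<longleftrightarrow> S = {x, x'}"
    by (rule inj_image_eq_iff) (simp add: inj_on_def)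
  then show ?thesis by simp
qed

lemma image_Pair_iff: "Pair c ` S = {(c, x), (c, x')} \<longleftrightarrow> S = {x, x'}"
proof -
  have "Pair c ` S = Pair c ` {x, x'} \<longleftrightarrow> S = {x, x'}"
    by (rule inj_image_eq_iff) (simp add: inj_on_def)
  then show ?thesis by simp
qed

lemma joins_color1: "joins (color_subgraph P (Suc 0)) b (x, y) (x', y') \<longleftrightarrow>
    (\<exists>b1. b = Edge (Inl b1) \<and> joins G1 b1 x x' \<and> y = e2 \<and> y' = e2) \<or>
    (b = Loop 1 (x, y) \<and> (x, y) = (x', y') \<and> (x, y) \<in> V \<and> y \<noteq> e2)"
proof (cases b)
  case (Edge c)
  show ?thesis
  proof (cases c)
    case (Inl b1)
    have "(\<lambda>x. (x, e2)) ` ends G1 b1 = {(x, y), (x', y')} \<longleftrightarrow>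
        ends G1 b1 = {x, x'} \<and> y = e2 \<and> y' = e2"
    proof
      assume *: "(\<lambda>x. (x, e2)) ` ends G1 b1 = {(x, y), (x', y')}"
      then have "(x, y) \<in> (\<lambda>x. (x, e2)) ` ends G1 b1" "(x', y') \<in> (\<lambda>x. (x, e2)) ` ends G1 b1"
        by simp_all
      then have "y = e2" "y' = e2" by blast+
      with * show "ends G1 b1 = {x, x'} \<and> y = e2 \<and> y' = e2"
        by (simp add: image_Pair_root_iff)
    qed (simp add: image_Pair_root_iff)
    then show ?thesis by (auto simp: Edge Inl product_defs joins_def image_iff)
  next
    case (Inr c2)
    then show ?thesis by (auto simp: Edge product_defs joins_def image_iff split: prod.splits)
  qed
next
  case (Loop i v)
  show ?thesis
    by (cases v) (auto simp: Loop product_defs joins_def image_iff doubleton_eq_iff)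
qed

lemma joins_color2: "joins (color_subgraph P 2) b (x, y) (x', y') \<longleftrightarrow>
    (\<exists>b2. b = Edge (Inr (x, b2)) \<and> joins G2 b2 y y' \<and> x = x' \<and> x \<in> verts G1 \<and> x \<noteq> e1) \<or>
    (b = Loop 2 (e1, e2) \<and> (x, y) = (e1, e2) \<and> (x', y') = (e1, e2))"
proof (cases b)
  case (Edge c)
  show ?thesis
  proof (cases c)
    case (Inr c2)
    obtain u b2 where c2: "c2 = (u, b2)" by (cases c2)
    have "Pair u ` ends G2 b2 = {(x, y), (x', y')} \<longleftrightarrow>
        ends G2 b2 = {y, y'} \<and> x = u \<and> x' = u"
    proof
      assume *: "Pair u ` ends G2 b2 = {(x, y), (x', y')}"
      then have "(x, y) \<in> Pair u ` ends G2 b2" "(x', y') \<in> Pair u ` ends G2 b2"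
        by simp_all
      then have "x = u" "x' = u" by blast+
      with * show "ends G2 b2 = {y, y'} \<and> x = u \<and> x' = u"
        by (simp add: image_Pair_iff)
    qed (simp add: image_Pair_iff)
    then show ?thesis by (auto simp: Edge Inr c2 product_defs joins_def image_iff)
  next
    case (Inl c2)
    then show ?thesis by (auto simp: Edge product_defs joins_def image_iff split: prod.splits)
  qed
next
  case (Loop i v)
  show ?thesis
    by (cases v) (auto simp: Loop product_defs joins_def image_iff doubleton_eq_iff)
qed

lemma card_if_singleton: "card (if Q then {a} else {}) = (if Q then 1 else 0)"
  by simp

lemma C1_eq: "C1 (x, y) (x', y') = (if y = e2 \<and> y' = e2 then K1 x x'
    else if (x, y) = (x', y') \<and> (x, y) \<in> V \<and> y \<noteq> e2 then 1 else 0)"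
proof (cases "y = e2 \<and> y' = e2")
  case True
  have "{b. joins (color_subgraph P (Suc 0)) b (x, y) (x', y')}
      = (\<lambda>b. Edge (Inl b)) ` {b. joins G1 b x x'}"
    using True by (auto simp: joins_color1)
  then show ?thesis using True by (simp add: n_edges_def card_image inj_on_def)
next
  case False
  let ?Q = "(x, y) = (x', y') \<and> (x, y) \<in> V \<and> y \<noteq> e2"
  have "joins (color_subgraph P (Suc 0)) b (x, y) (x', y') \<longleftrightarrow> ?Q \<and> b = Loop 1 (x, y)" for b
    using False joins_color1[of b x y x' y'] by blast
  then have "{b. joins (color_subgraph P (Suc 0)) b (x, y) (x', y')}
      = (if ?Q then {Loop 1 (x, y)} else {})"
    by auto
  then show ?thesis
    unfolding if_not_P[OF False] n_edges_def[of "color_subgraph P (Suc 0)"]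
    by (simp only: card_if_singleton)
qed

lemma C2_eq: "C2 (x, y) (x', y') = (if x = x' \<and> x \<in> verts G1 \<and> x \<noteq> e1 then K2 y y'
    else if (x, y) = (e1, e2) \<and> (x', y') = (e1, e2) then 1 else 0)"
proof (cases "x = x' \<and> x \<in> verts G1 \<and> x \<noteq> e1")
  case True
  have "{b. joins (color_subgraph P 2) b (x, y) (x', y')}
      = (\<lambda>b. Edge (Inr (x, b))) ` {b. joins G2 b y y'}"
    using True by (auto simp: joins_color2)
  then have "C2 (x, y) (x', y') = K2 y y'" by (simp add: n_edges_def card_image inj_on_def)
  then show ?thesis by (simp only: if_P[OF True])
next
  case False
  let ?Q = "(x, y) = (e1, e2) \<and> (x', y') = (e1, e2)"
  have "joins (color_subgraph P 2) b (x, y) (x', y') \<longleftrightarrow> ?Q \<and> b = Loop 2 (e1, e2)" for b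
    using False joins_color2[of b x y x' y'] by blast
  then have "{b. joins (color_subgraph P 2) b (x, y) (x', y')}
      = (if ?Q then {Loop 2 (e1, e2)} else {})"
    by auto
  then show ?thesis
    unfolding if_not_P[OF False] n_edges_def[of "color_subgraph P 2"]
    by (simp only: card_if_singleton)
qed

text \<open>Edges of the first graph stay at second coordinate \<open>e2\<close>; every other vertex
  meets color 1 in its attached loop alone, whence the identity there.\<close>

lemma kernel_op_C1: "kernel_op C1 f (x, y) =
    (if y = e2 then kernel_op K1 (\<lambda>x. f (x, e2)) x else if (x, y) \<in> V then f (x, y) else 0)"
proof (cases "y = e2")
  case True
  have "{u. C1 u (x, y) \<noteq> 0} = (\<lambda>x. (x, e2)) ` {x'. K1 x' x \<noteq> 0}"
    by (auto simp: C1_eq True split: if_splits)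
  then show ?thesis
    by (simp add: kernel_op_def True C1_eq sum.reindex inj_on_def)
next
  case False
  then have "{u. C1 u (x, y) \<noteq> 0} = (if (x, y) \<in> V then {(x, y)} else {})"
    by (auto simp: C1_eq split: if_splits)
  then show ?thesis by (auto simp: kernel_op_def C1_eq False)
qed

text \<open>Each vertex of the first graph other than \<open>e1\<close> carries its own copy of the
  second graph; over \<open>e1\<close> there is only the root with its loop.\<close>

lemma kernel_op_C2: "kernel_op C2 f (x, y) =
    (if x \<in> verts G1 \<and> x \<noteq> e1 then kernel_op K2 (\<lambda>y. f (x, y)) y
     else if (x, y) = (e1, e2) then f (e1, e2) else 0)"
proof (cases "x \<in> verts G1 \<and> x \<noteq> e1")
  case True
  have "{u. C2 u (x, y) \<noteq> 0} = Pair x ` {y'. K2 y' y \<noteq> 0}"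
    using True by (auto simp: C2_eq split: if_splits)
  then show ?thesis
    using True by (simp add: kernel_op_def C2_eq sum.reindex inj_on_def)
next
  case False
  have C2: "C2 u (x, y) = (if u = (e1, e2) \<and> (x, y) = (e1, e2) then 1 else 0)" for u
  proof (cases u)
    case (Pair a b)
    have "\<not> (a = x \<and> a \<in> verts G1 \<and> a \<noteq> e1)" using False by blast
    then show ?thesis by (simp only: Pair C2_eq if_False)
  qed
  show ?thesis
    unfolding if_not_P[OF False] kernel_op_def C2 by (cases "(x, y) = (e1, e2)") simp_all
qed

lemma color_adj_eq: "color_adj P (Suc 0) = kernel_op C1" "color_adj P 2 = kernel_op C2"
  using adj_eq_kernel_op[OF multi_P(2)] by (simp_all add: color_adj_def)

lemma finite_neighbours_P: "finite {u. n_edges (color_subgraph P i) u v \<noteq> 0}"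
proof -
  obtain d where "degree_bound P d"
    using degree_bound_orth_loop_product[OF rooted1 rooted2] by blast
  then have "finite {u \<in> verts (color_subgraph P i). n_edges (color_subgraph P i) v u \<noteq> 0}"
    by (rule finite_neighbours[OF multi_P(2) color_subgraph_degree_bound])
  moreover have "{u. n_edges (color_subgraph P i) u v \<noteq> 0}
      \<subseteq> {u \<in> verts (color_subgraph P i). n_edges (color_subgraph P i) v u \<noteq> 0}"
  proof
    fix u assume "u \<in> {u. n_edges (color_subgraph P i) u v \<noteq> 0}"
    then show "u \<in> {u \<in> verts (color_subgraph P i). n_edges (color_subgraph P i) v u \<noteq> 0}"
      using n_edges_outside[OF multi_P(2)[of i], of u v]
        n_edges_commute[of "color_subgraph P i" u v] by (metis (mono_tags) mem_Collect_eq)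
  qed
  ultimately show ?thesis by (rule rev_finite_subset)
qed

subsection \<open>The distribution of \<open>R\<^sub>2 R\<^sub>1\<close>\<close>

abbreviation "e \<equiv> (e1, e2)"
abbreviation "Z \<equiv> kernel_op C2 \<circ> (kernel_op C1 :: ('v1 \<times> 'v2) oper)"

lemma eta_spectral:
  "eta_series (spectral_distribution G1) = fps_X * Abs_fps (return_coeff e1 (kernel_op K1))"
  "eta_series (spectral_distribution G2) = fps_X * Abs_fps (return_coeff e2 (kernel_op K2))"
  by (simp_all add: spectral_distribution_def adj_eq_kernel_op multi
      eta_series_first_return lin_oper_kernel_op)

lemma return_coeff_Z:
  "Abs_fps (return_coeff e Z) =
    Abs_fps (return_coeff e1 (kernel_op K1)) oo eta_series (spectral_distribution G2)"
proof -
  \<comment> \<open>\<open>U\<close> collects the avoiding powers of \<open>Z\<close>,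
    \<open>H\<close> is \<open>U\<close> after the half step of color 1, and \<open>W\<close> is
    \<open>U\<close> on the copy of the first graph.\<close>
  define U where "U = (\<lambda>v. Abs_fps (\<lambda>n. (avoid e Z ^^ n) (delta e) v))"
  define H where "H = kernel_op C1 U"
  define W where "W = (\<lambda>x. U (x, e2))"
  let ?\<eta> = "eta_series (spectral_distribution G2)"
  let ?\<rho> = "Abs_fps (return_coeff e2 (kernel_op K2))"
  have nthZ: "fps_nth (kernel_op C2 H v) n = Z ((avoid e Z ^^ n) (delta e)) v" for v n
    by (simp add: H_def kernel_op_fps_nth U_def)
  have Ue: "U e = 1"
  proof (rule fps_ext)
    fix n show "fps_nth (U e) n = fps_nth 1 n"
      by (cases n) (simp_all add: U_def delta_def avoid_def)
  qed
  have UX: "U v = fps_X * kernel_op C2 H v" if "v \<noteq> e" for v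
  proof (rule fps_ext)
    fix n show "fps_nth (U v) n = fps_nth (fps_X * kernel_op C2 H v) n"
      using that by (cases n) (simp_all add: nthZ, simp_all add: U_def delta_def avoid_def)
  qed
  have Uout: "U v = 0" if "v \<notin> V" for v
  proof -
    have "kernel_op C2 H v = 0"
      by (rule kernel_op_outside[OF multi_P(2)]) (simp only: verts_P that not_False_eq_True)
    moreover have "v \<noteq> e" using that base_in by auto
    ultimately show ?thesis using UX[of v] by simp
  qed
  \<comment> \<open>Here the copy attached at \<open>x\<close> is eliminated: its first-return
    series is all that remains of it.\<close>
  have W: "W x = ?\<eta> * kernel_op K1 W x" if x: "x \<noteq> e1" for x
  proof (cases "x \<in> verts G1")
    case False
    then show ?thesis using Uout[of "(x, e2)"] by (simp add: W_def kernel_op_outside multi)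
  next
    case True
    define h where "h = (\<lambda>y. H (x, y))"
    have C2H: "kernel_op C2 H (x, y) = kernel_op K2 h y" for y
      using x True by (simp add: kernel_op_C2 h_def)
    \<comment> \<open>Color 1 is the identity off \<open>e2\<close>, so \<open>h\<close> coincides
      with \<open>U\<close> there and satisfies the hypothesis of the resolvent lemma with
      \<open>s = fps_X\<close>.\<close>
    have "h y = fps_X * kernel_op K2 h y" if y: "y \<noteq> e2" for y
    proof (cases "y \<in> verts G2")
      case False
      then show ?thesis using y by (simp add: h_def H_def kernel_op_C1 kernel_op_outside multi)
    next
      case yin: True
      have "h y = U (x, y)" using x y yin True by (simp add: h_def H_def kernel_op_C1)
      also have "\<dots> = fps_X * kernel_op K2 h y" using x UX[of "(x, y)"] by (simp add: C2H)
      finally show ?thesis .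
    qed
    then have "kernel_op K2 h e2 = h e2 * (?\<rho> oo fps_X)"
      by (intro kernel_op_resolvent) simp_all
    moreover have "h e2 = kernel_op K1 W x" by (simp add: h_def H_def kernel_op_C1 W_def)
    moreover have "W x = fps_X * kernel_op K2 h e2" using x UX[of "(x, e2)"] by (simp add: W_def C2H)
    ultimately show ?thesis by (simp add: eta_spectral mult_ac)
  qed
  have "kernel_op K1 W e1 = W e1 * (Abs_fps (return_coeff e1 (kernel_op K1)) oo ?\<eta>)"
    by (rule kernel_op_resolvent[OF _ W]) (simp add: eta_spectral)
  moreover have "Abs_fps (return_coeff e Z) = kernel_op C2 H e"
    by (rule fps_ext) (simp only: nthZ return_coeff_def fps_nth_Abs_fps)
  \<comment> \<open>Color 2 meets the root in its loop only, so the last half step is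
    trivial.\<close>
  moreover have "kernel_op C2 H e = H e" by (simp add: kernel_op_C2)
  moreover have "H e = kernel_op K1 W e1" by (simp add: H_def kernel_op_C1 W_def)
  ultimately show ?thesis using Ue by (simp add: W_def)
qed

lemma eta_Z:
  "eta_series (distribution (vec_state (delta e)) Z) =
    eta_series (orth_mult_conv (spectral_distribution G1) (spectral_distribution G2))"
proof -
  have "rho_series (spectral_distribution G1) = Abs_fps (return_coeff e1 (kernel_op K1))"
    unfolding rho_series_def eta_spectral by (rule nonzero_mult_div_cancel_left) simp
  then show ?thesis
    by (simp add: orth_mult_conv(2) eta_series_first_return lin_oper_comp lin_oper_kernel_op
        return_coeff_Z)
qed

subsection \<open>Alternating d-walks\<close>

text \<open>Color 1 comes first since \<open>R1\<close> acts first in \<open>Z\<close>. The root is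
  forbidden only at positive even times, when \<open>avoid e Z\<close> projects; at odd times it
  stays allowed, because the last step of a d-walk is the loop at \<open>e\<close>.\<close>

abbreviation "alt_graph \<equiv> \<lambda>i::nat. color_subgraph P (if even i then 1 else 2)"
abbreviation "alt_avoid \<equiv> \<lambda>i::nat. if even i \<and> i \<noteq> 0 then - {e} else UNIV"

text \<open>Two steps of the count are one application of \<open>Z\<close>, and the mask at even
  times is the projection inside \<open>avoid e Z\<close>.\<close>

lemma card_alt_paths:
  "of_nat (card (path_set alt_graph alt_avoid e (2 * Suc n) v)) = Z ((avoid e Z ^^ n) (delta e)) v"
proof -
  define c :: "nat \<Rightarrow> 'v1 \<times> 'v2 \<Rightarrow> complex"
    where "c = (\<lambda>n v. of_nat (card (path_set alt_graph alt_avoid e n v)))"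
  have step: "c (Suc m) = kernel_op (n_edges (alt_graph m)) (\<lambda>x. if x \<in> alt_avoid m then c m x else 0)"
    for m
    unfolding c_def by (rule ext) (rule card_path_set(2)[OF finite_joins_P finite_neighbours_P])
  have odd: "c (Suc (Suc (2 * m))) = Z (\<lambda>x. if m \<noteq> 0 \<and> x = e then 0 else c (2 * m) x)" for m
  proof -
    have "c (Suc (2 * m)) = kernel_op C1 (\<lambda>x. if m \<noteq> 0 \<and> x = e then 0 else c (2 * m) x)"
      unfolding step[of "2 * m"] by (rule arg_cong2[of _ _ _ _ kernel_op]) (auto simp: fun_eq_iff)
    then show ?thesis unfolding step[of "Suc (2 * m)"] by simp
  qed
  have "c (2 * Suc n) = Z ((avoid e Z ^^ n) (delta e))"
  proof (induction n)
    case 0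
    have "c 0 = delta e" by (auto simp: c_def path_set_0 delta_def)
    then show ?case using odd[of 0] by (simp add: numeral_2_eq_2)
  next
    case (Suc n)
    have "c (2 * Suc (Suc n)) = Z (\<lambda>x. if x = e then 0 else c (2 * Suc n) x)"
      using odd[of "Suc n"] by simp
    also have "(\<lambda>x. if x = e then 0 else c (2 * Suc n) x) = (avoid e Z ^^ Suc n) (delta e)"
      unfolding Suc.IH by (simp add: avoid_def)
    finally show ?case .
  qed
  then show ?thesis by (simp only: c_def fun_eq_iff)
qed

text \<open>No copy of the second graph is attached at the root, so the only edge of color 2 there
  is a loop.\<close>

lemma color2_at_root: "joins (color_subgraph P 2) b u v \<Longrightarrow> u = e \<longleftrightarrow> v = e"
  by (cases u; cases v) (auto simp: joins_color2)

lemma alt_graph_iff: "joins (alt_graph i) b u v \<longleftrightarrow> joins P b u v \<and> color P b = (if even i then 1 else 2)"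
  by (auto simp: joins_def color_subgraph_def)

lemma color_P: "b \<in> edges P \<Longrightarrow> color P b = 1 \<or> color P b = 2"
  by (auto simp: product_defs)

text \<open>The last edge has color 2 and ends at the root, so it is the loop there; this loop is
  the whole second f-walk. For \<open>n = 0\<close> the trivial path belongs to
  \<open>path_set\<close> but is no d-walk.\<close>

lemma d_walks_eq_path_set:
  assumes n: "n \<noteq> 0"
  shows "d_walks P e (2 * n) = path_set alt_graph alt_avoid e (2 * n) e" (is "?D = ?Q")
proof (intro equalityI subsetI)
  fix w assume "w \<in> ?D"
  then have len: "walk_length w = 2 * n" and w: "is_walk P w" "alternating P w"
      "color P (hd (snd w)) = 1"
    and "\<exists>u1 u2. f_walk P e u1 \<and> f_walk P e u2 \<and> w = walk_append u1 u2"
    by (auto simp: d_walks_def alternating_d_walk_def)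
  then obtain vs1 bs1 vs2 bs2 where u: "f_walk P e (vs1, bs1)" "f_walk P e (vs2, bs2)"
    and weq: "w = (vs1 @ tl vs2, bs1 @ bs2)"
    by (auto simp: walk_append_def)
  define vs where "vs = vs1 @ tl vs2"
  define bs where "bs = bs1 @ bs2"
  have wv: "w = (vs, bs)" by (simp add: weq vs_def bs_def)
  have lbs: "length bs = 2 * n" using len by (simp add: wv walk_length_def)
  have lvs: "length vs = Suc (2 * n)" and J: "\<And>i. i < 2 * n \<Longrightarrow> joins P (bs ! i) (vs ! i) (vs ! Suc i)"
    using w(1) lbs by (auto simp: wv is_walk_def)
  have col: "color P (bs ! i) = (if even i then 1 else 2)" if "i < 2 * n" for i
    using that
  proof (induction i)
    case 0
    then show ?case using w(3) lbs n by (simp add: wv hd_conv_nth flip: length_0_conv)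
  next
    case (Suc i)
    have "color P (bs ! i) \<noteq> color P (bs ! Suc i)"
      using w(2) Suc.prems lbs by (auto simp: wv alternating_def walk_length_def)
    moreover have "color P (bs ! Suc i) = 1 \<or> color P (bs ! Suc i) = 2"
      using J[OF Suc.prems] color_P by (auto simp: joins_def)
    ultimately show ?case using Suc by auto
  qed
  have l: "length vs1 = Suc (length bs1)" "length vs2 = Suc (length bs2)"
    and pos: "length bs1 \<ge> 1" "length bs2 \<ge> 1"
    and first: "hd vs1 = e" and last: "last vs2 = e"
    and avoid1: "\<And>i. 1 \<le> i \<Longrightarrow> i < length bs1 \<Longrightarrow> vs1 ! i \<noteq> e"
    and avoid2: "\<And>i. 1 \<le> i \<Longrightarrow> i < length bs2 \<Longrightarrow> vs2 ! i \<noteq> e"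
    using u by (auto simp: f_walk_def walk_from_to_def is_walk_def walk_length_def)
  have lsum: "length bs1 + length bs2 = 2 * n" using lbs by (simp add: bs_def)
  have nth1: "vs ! i = vs1 ! i" if "i \<le> length bs1" for i
    using that l by (simp add: vs_def nth_append)
  have nth2: "vs ! (length bs1 + i) = vs2 ! i" if i: "1 \<le> i" "i \<le> length bs2" for i
  proof -
    obtain k where "i = Suc k" using i(1) by (cases i) auto
    then show ?thesis using i(2) l by (simp add: vs_def nth_append nth_tl)
  qed
  have v0: "vs ! 0 = e" using first l nth1[of 0] by (cases vs1) auto
  have vn: "vs ! (2 * n) = e"
    using nth2[of "length bs2"] last l pos lsum by (cases vs2 rule: rev_cases) (auto simp: nth_append)
  \<comment> \<open>Edges are indexed from 0, so the last one has odd index and hence color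
    2.\<close>
  have "odd (2 * n - 1)" "Suc (2 * n - 1) = 2 * n" using n by auto
  then have "joins (color_subgraph P 2) (bs ! (2 * n - 1)) (vs ! (2 * n - 1)) (vs ! (2 * n))"
    using J[of "2 * n - 1"] col[of "2 * n - 1"] by (auto simp: joins_def color_subgraph_def)
  then have vpen: "vs ! (2 * n - 1) = e" using color2_at_root vn by blast
  \<comment> \<open>A longer second f-walk would visit the root one step before its end.\<close>
  have l2: "length bs2 = 1"
  proof (rule ccontr)
    assume "length bs2 \<noteq> 1"
    then have "vs2 ! (length bs2 - 1) \<noteq> e" using pos by (intro avoid2) auto
    moreover have "vs2 ! (length bs2 - 1) = vs ! (2 * n - 1)"
      using nth2[of "length bs2 - 1"] pos lsum \<open>length bs2 \<noteq> 1\<close> by simp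
    ultimately show False using vpen by simp
  qed
  \<comment> \<open>An even index below \<open>2 * n\<close> differs from \<open>2 * n - 1\<close>,
    so it lies strictly inside the first f-walk.\<close>
  have "vs ! i \<noteq> e" if "i < 2 * n" "even i" "i \<noteq> 0" for i
  proof -
    have "i \<noteq> 2 * n - 1" using that(2) \<open>odd (2 * n - 1)\<close> by metis
    then have "i < length bs1" using that(1) lsum l2 by linarith
    then show ?thesis using avoid1[of i] nth1[of i] that(3) by simp
  qed
  then have "vs ! i \<in> alt_avoid i \<and> joins (alt_graph i) (bs ! i) (vs ! i) (vs ! Suc i)"
    if "i < 2 * n" for i
    using that J[OF that] col[OF that] unfolding alt_graph_iff by auto
  then show "w \<in> ?Q" using v0 vn lvs lbs by (simp only: path_set_def wv) blast
next
  fix w assume "w \<in> ?Q"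
  then obtain vs bs where wv: "w = (vs, bs)" and lbs: "length bs = 2 * n"
    and lvs: "length vs = Suc (2 * n)" and v0: "vs ! 0 = e" and vn: "vs ! (2 * n) = e"
    and J: "\<And>i. i < 2 * n \<Longrightarrow> vs ! i \<in> alt_avoid i \<and> joins (alt_graph i) (bs ! i) (vs ! i) (vs ! Suc i)"
    unfolding path_set_def by blast
  obtain m where m: "2 * n = Suc m" "odd m"
    by (rule that[of "2 * n - 1"]) (use n in auto)
  have JP: "joins P (bs ! i) (vs ! i) (vs ! Suc i)" "color P (bs ! i) = (if even i then 1 else 2)"
    if "i < 2 * n" for i using J[OF that] unfolding alt_graph_iff by blast+
  have J2: "joins (color_subgraph P 2) (bs ! i) (vs ! i) (vs ! Suc i)" if "i < 2 * n" "odd i" for i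
    using J[OF that(1)] that(2) by simp
  have verts: "vs ! i \<in> verts P" if "i \<le> 2 * n" for i
  proof (cases "i = 2 * n")
    case True
    then show ?thesis using vn base_in by (simp add: verts_P)
  next
    case False
    then show ?thesis using that JP(1)[of i] multigraph_joins[OF multi_P(1)] by simp
  qed
  then have "set vs \<subseteq> verts P"
    using lvs by (metis in_set_conv_nth less_Suc_eq_le subsetI)
  then have walk: "is_walk P w" using JP(1) lvs lbs by (simp add: wv is_walk_def)
  have "vs ! m = e" using color2_at_root[OF J2[of m]] m vn by simp
  then have vs: "vs = take (Suc m) vs @ [e]" and tvs: "last (take (Suc m) vs) = e"
    using lvs vn m take_Suc_conv_app_nth[of "Suc m" vs] take_Suc_conv_app_nth[of m vs] by simp_all
  have bs: "bs = take m bs @ [bs ! m]"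
    using lbs m take_Suc_conv_app_nth[of m bs] by simp
  have hd: "hd (take (Suc m) vs) = e" using v0 lvs by (cases vs) auto
  \<comment> \<open>The mask covers even times. From the root at an odd time, color 2 would lead
    back to the root at the next even time, where it is forbidden.\<close>
  have ne: "vs ! i \<noteq> e" if "1 \<le> i" "i < m" for i
  proof (cases "even i")
    case True
    then show ?thesis using J[of i] that m by auto
  next
    case False
    show ?thesis
    proof
      assume "vs ! i = e"
      then have "vs ! Suc i = e" using color2_at_root[OF J2[of i]] False that m by simp
      moreover have "vs ! Suc i \<in> alt_avoid (Suc i)" using J[of "Suc i"] that m by simp
      ultimately show False using False by simp
    qed
  qed
  have "is_walk P (take (Suc m) vs, take m bs)"
    using walk lvs lbs m by (auto simp: wv is_walk_def dest: in_set_takeD)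
  then have f1: "f_walk P e (take (Suc m) vs, take m bs)"
    using hd tvs ne lbs m odd_pos[OF m(2)] by (auto simp: f_walk_def walk_from_to_def walk_length_def)
  have "is_walk P ([e, e], [bs ! m])"
    using JP(1)[of m] \<open>vs ! m = e\<close> vn m verts[of 0] v0 by (auto simp: is_walk_def)
  then have f2: "f_walk P e ([e, e], [bs ! m])"
    by (simp add: f_walk_def walk_from_to_def walk_length_def)
  have "w = walk_append (take (Suc m) vs, take m bs) ([e, e], [bs ! m])"
    using vs bs by (simp add: wv walk_append_def)
  moreover have "alternating P w" using JP(2) lbs by (simp add: wv alternating_def walk_length_def)
  moreover have "color P (hd (snd w)) = 1"
    using JP(2)[of 0] n lbs by (simp add: wv hd_conv_nth flip: length_greater_0_conv)
  moreover have "walk_length w = 2 * n" using lbs by (simp add: wv walk_length_def)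
  ultimately show "w \<in> ?D"
    using walk f1 f2 unfolding d_walks_def alternating_d_walk_def mem_Collect_eq by blast
qed

subsection \<open>Orthogonality\<close>

abbreviation "S1 \<equiv> kernel_op C1 - (id :: ('v1 \<times> 'v2) oper)"
abbreviation "S2 \<equiv> kernel_op C2 - (id :: ('v1 \<times> 'v2) oper)"

lemma supported_kernel_op: "supported V f \<Longrightarrow> supported V ((kernel_op (n_edges (color_subgraph P i)) - id) f)"
  unfolding supported_def
proof (intro allI impI)
  fix v assume f: "\<forall>v. v \<notin> V \<longrightarrow> f v = 0" and v: "v \<notin> V"
  have "kernel_op (n_edges (color_subgraph P i)) f v = 0"
    by (rule kernel_op_outside[OF multi_P(2)]) (simp only: verts_P v not_False_eq_True)
  moreover have "f v = 0" using f v by blast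
  ultimately show "(kernel_op (n_edges (color_subgraph P i)) - id) f v = 0" by simp
qed

lemma supported_gen_alg_color:
  "T \<in> gen_alg {kernel_op (n_edges (color_subgraph P i)) - id} \<Longrightarrow> supported V f \<Longrightarrow> supported V (T f)"
  by (erule supported_gen_alg) (simp_all only: singleton_iff supported_kernel_op)

text \<open>The loops of color 1 cancel against the identity, leaving only the copy of the first
  graph.\<close>

lemma S1_apply: "supported V f \<Longrightarrow>
    S1 f (x, y) = (if y = e2 then kernel_op K1 (\<lambda>x. f (x, e2)) x - f (x, e2) else 0)"
  by (auto simp: kernel_op_C1 supported_def)

text \<open>The loop at the root cancels against the identity, and all copies carry the same
  operator of the second graph.\<close>

lemma S2_apply: "supported V f \<Longrightarrow>
    S2 f (x, y) = (if x = e1 then 0 else (kernel_op K2 - id) (\<lambda>y. f (x, y)) y)"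
proof (cases "x = e1 \<or> x \<in> verts G1")
  case True
  then show "supported V f \<Longrightarrow> ?thesis" by (auto simp: kernel_op_C2 supported_def)
next
  case False
  assume "supported V f"
  then have "f (x, y) = 0" for y using False by (auto simp: supported_def)
  then show ?thesis
    using False by (auto simp: kernel_op_C2 lin_oper_zero[OF lin_oper_kernel_op])
qed

text \<open>The projection onto the copy of the first graph, kept on the product so that it composes
  with the operators there.\<close>

definition slice :: "('v1 \<times> 'v2 \<Rightarrow> complex) \<Rightarrow> 'v1 \<times> 'v2 \<Rightarrow> complex" where
  "slice f = (\<lambda>(x, y). if y = e2 then f (x, y) else 0)"

lemma slice_linear:
  "slice (\<lambda>v. f v + g v) = (\<lambda>v. slice f v + slice g v)" "slice (\<lambda>v. c * f v) = (\<lambda>v. c * slice f v)"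
  by (auto simp: slice_def)

lemma supported_slice: "supported V f \<Longrightarrow> supported V (slice f)"
  by (auto simp: supported_def slice_def)

text \<open>\<open>S1\<close> reads and writes only the copy of the first graph. This passes to the
  non-unital algebra; the identity lacks the property in general.\<close>

lemma gen_alg_S1:
  assumes "T \<in> gen_alg {S1}" "supported V f"
  shows "T (slice f) = T f" and "slice (T f) = T f"
proof -
  have "supported V f \<longrightarrow> T (slice f) = T f \<and> slice (T f) = T f"
    using assms(1)
  proof (induction arbitrary: f)
    case (gen T)
    show ?case
    proof
      assume f: "supported V f"
      have "T (slice f) v = T f v" "slice (T f) v = T f v" for v
        using gen S1_apply[OF f] S1_apply[OF supported_slice[OF f]]
        by (cases v; simp del: fun_diff_def minus_apply add: slice_def)+
      then show "T (slice f) = T f \<and> slice (T f) = T f" by blast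
    qed
  next
    case (comp T U)
    show ?case
    proof
      assume f: "supported V f"
      have "supported V (U f)"
        by (rule supported_gen_alg_color[OF comp.hyps(2) f])
      then show "(T \<circ> U) (slice f) = (T \<circ> U) f \<and> slice ((T \<circ> U) f) = (T \<circ> U) f"
        using comp.IH f by simp
    qed
  next
    case (add T U)
    then show ?case by (simp add: slice_linear)
  next
    case (scale T c)
    then show ?case by (simp add: slice_linear)
  qed (simp add: slice_def fun_eq_iff)
  then show "T (slice f) = T f" "slice (T f) = T f" using assms(2) by blast+
qed

text \<open>\<open>S\<close> does not depend on \<open>x\<close>; this is why compression to the
  copy of the first graph gives one scalar for all its non-root vertices.\<close>

lemma gen_alg_S2:
  assumes "T \<in> gen_alg {S2}"
  obtains S where "lin_oper S" and
    "\<And>f x y. supported V f \<Longrightarrow> T f (x, y) = (if x = e1 then 0 else S (\<lambda>y. f (x, y)) y)"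
proof -
  have "\<exists>S. lin_oper S \<and> (\<forall>f. supported V f \<longrightarrow>
      (\<forall>x y. T f (x, y) = (if x = e1 then 0 else S (\<lambda>y. f (x, y)) y)))"
    using assms
  proof induction
    case (gen T)
    then have T: "T = S2" by blast
    show ?case
      unfolding T by (intro exI[of _ "kernel_op K2 - id"] conjI allI impI)
        (rule lin_oper_minus_id[OF lin_oper_kernel_op], rule S2_apply)
  next
    case zero
    show ?case by (rule exI[of _ "\<lambda>f x. 0"]) (simp add: lin_oper_def)
  next
    case (add T U)
    then obtain A B where "lin_oper A" "lin_oper B"
      "\<forall>f. supported V f \<longrightarrow> (\<forall>x y. T f (x, y) = (if x = e1 then 0 else A (\<lambda>y. f (x, y)) y))"
      "\<forall>f. supported V f \<longrightarrow> (\<forall>x y. U f (x, y) = (if x = e1 then 0 else B (\<lambda>y. f (x, y)) y))"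
      by blast
    then show ?case
      by (intro exI[of _ "\<lambda>f x. A f x + B f x"]) (simp add: lin_oper_def algebra_simps)
  next
    case (scale T c)
    then obtain A where "lin_oper A"
      "\<forall>f. supported V f \<longrightarrow> (\<forall>x y. T f (x, y) = (if x = e1 then 0 else A (\<lambda>y. f (x, y)) y))"
      by blast
    then show ?case
      by (intro exI[of _ "\<lambda>f x. c * A f x"]) (simp add: lin_oper_def algebra_simps)
  next
    case (comp T U)
    then obtain A B where lin: "lin_oper A" "lin_oper B" and
      T: "\<And>f x y. supported V f \<Longrightarrow> T f (x, y) = (if x = e1 then 0 else A (\<lambda>y. f (x, y)) y)" and
      U: "\<And>f x y. supported V f \<Longrightarrow> U f (x, y) = (if x = e1 then 0 else B (\<lambda>y. f (x, y)) y)"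
      by blast
    have "(T \<circ> U) f (x, y) = (if x = e1 then 0 else (A \<circ> B) (\<lambda>y. f (x, y)) y)"
      if f: "supported V f" for f x y
    proof -
      have "supported V (U f)"
        by (rule supported_gen_alg_color[OF comp.hyps(2) f])
      then show ?thesis by (simp add: T U f)
    qed
    then show ?case using lin_oper_comp[OF lin] by blast
  qed
  then show ?thesis using that by blast
qed

lemma ell2_inner_embed1:
  assumes "\<And>x. T (x, e2) * cnj (\<zeta> x) = c * (\<zeta> x * cnj (\<zeta> x))" and "ell2_inner \<zeta> \<zeta> = 1"
  shows "ell2_inner T (embed1 G2 \<zeta>) = c"
proof -
  have "ell2_inner T (embed1 G2 \<zeta>) =
      (\<Sum>\<^sub>\<infinity>v\<in>range (\<lambda>x. (x, e2)). T v * cnj (embed1 G2 \<zeta> v))"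
    unfolding ell2_inner_def by (rule infsum_cong_neutral) (auto simp: embed1_def image_iff split: if_splits)
  also have "\<dots> = (\<Sum>\<^sub>\<infinity>x. c * (\<zeta> x * cnj (\<zeta> x)))"
    by (subst infsum_reindex) (auto simp: inj_on_def embed1_def assms(1) comp_def)
  also have "\<dots> = c * ell2_inner \<zeta> \<zeta>"
    unfolding ell2_inner_def by (rule infsum_cmult_right')
  finally show ?thesis using assms(2) by simp
qed

lemma orthogonal_S1_S2:
  assumes \<zeta>: "\<zeta> \<in> ell2 (verts G1 - {e1})" "ell2_inner \<zeta> \<zeta> = 1"
  shows "orthogonal_pair S1 S2 (vec_state (delta e)) (vec_state (embed1 G2 \<zeta>))"
proof -
  let ?A1 = "gen_alg {S1}" and ?A2 = "gen_alg {S2}"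
  let ?W = "gen_alg (insert id (?A1 \<union> ?A2))"
  have lin1: "lin_oper T" if "T \<in> ?A1" for T
    using that by (rule lin_oper_gen_alg) (simp add: lin_oper_minus_id lin_oper_kernel_op)
  have lin2: "lin_oper T" if "T \<in> ?A2" for T
    using that by (rule lin_oper_gen_alg) (simp add: lin_oper_minus_id lin_oper_kernel_op)
  have linW: "lin_oper T" if "T \<in> ?W" for T
    using that by (rule lin_oper_gen_alg) (use lin1 lin2 in \<open>auto simp: lin_oper_def\<close>)
  have sup1: "supported V (T f)" if "T \<in> ?A1" "supported V f" for T f
    using that by (rule supported_gen_alg_color)
  have sup2: "supported V (T f)" if "T \<in> ?A2" "supported V f" for T f
    using that by (rule supported_gen_alg_color)
  have supW: "supported V (T f)" if "T \<in> ?W" "supported V f" for T f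
    by (rule supported_gen_alg[OF that(1) _ that(2)]) (use sup1 sup2 in auto)
  have sup\<delta>: "supported V (delta e)"
    using base_in by (auto simp: supported_def delta_def)
  have \<zeta>0: "\<zeta> x = 0" if "x \<notin> verts G1 - {e1}" for x
    using \<zeta>(1) that unfolding ell2_def by blast
  have sup\<zeta>: "supported V (embed1 G2 \<zeta>)"
    using \<zeta>0 base_in by (auto simp: supported_def embed1_def)
  \<comment> \<open>\<open>b\<close> gives 0 at the root, and it kills \<open>delta e\<close>, which
    vanishes on every copy where \<open>S\<close> is applied.\<close>
  have i: "(b \<circ> w2) (delta e) e = 0" "(w1 \<circ> b) (delta e) e = 0"
    if b: "b \<in> ?A2" and w: "w1 \<in> ?W" "w2 \<in> ?W" for b w1 w2
  proof -
    obtain S where S: "lin_oper S"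
      "\<And>f x y. supported V f \<Longrightarrow> b f (x, y) = (if x = e1 then 0 else S (\<lambda>y. f (x, y)) y)"
      using gen_alg_S2[OF b] by blast
    show "(b \<circ> w2) (delta e) e = 0" using S(2)[OF supW[OF w(2) sup\<delta>]] by simp
    have "b (delta e) = (\<lambda>v. 0)"
    proof
      fix v
      have "(\<lambda>y. delta e (x, y)) = (\<lambda>y. 0)" if "x \<noteq> e1" for x
        using that by (auto simp: delta_def)
      then show "b (delta e) v = 0"
        by (cases v) (simp add: S(2)[OF sup\<delta>] lin_oper_zero[OF S(1)])
    qed
    then show "(w1 \<circ> b) (delta e) e = 0" by (simp add: lin_oper_zero[OF linW[OF w(1)]])
  qed
  have ii: "(w1 \<circ> a1 \<circ> b \<circ> a2 \<circ> w2) (delta e) e = vec_state (embed1 G2 \<zeta>) b *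
      ((w1 \<circ> a1 \<circ> a2 \<circ> w2) (delta e) e - (w1 \<circ> a1) (delta e) e * (a2 \<circ> w2) (delta e) e)"
    if a: "a1 \<in> ?A1" "a2 \<in> ?A1" and b: "b \<in> ?A2" and w: "w1 \<in> ?W" "w2 \<in> ?W"
    for a1 a2 b w1 w2
  proof -
    obtain S where S: "lin_oper S"
      "\<And>f x y. supported V f \<Longrightarrow> b f (x, y) = (if x = e1 then 0 else S (\<lambda>y. f (x, y)) y)"
      using gen_alg_S2[OF b] by blast
    \<comment> \<open>The diagonal entry of \<open>S\<close> at the root of the second graph is the
      scalar of the compression.\<close>
    define c where "c = S (delta e2) e2"
    have bs: "b f (x, e2) = (if x = e1 then 0 else f (x, e2) * c)"
      if "supported V f" "slice f = f" for f x
    proof -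
      have "f (x, y) = f (x, e2) * delta e2 y" for y
        using fun_cong[OF that(2), of "(x, y)"] by (auto simp: slice_def delta_def split: if_splits)
      then have "(\<lambda>y. f (x, y)) = (\<lambda>y. f (x, e2) * delta e2 y)" by blast
      then show ?thesis
        using S(2)[OF that(1)] lin_oper_scale[OF S(1), of "f (x, e2)" "delta e2"]
        by (simp add: c_def)
    qed
    have "slice (embed1 G2 \<zeta>) = embed1 G2 \<zeta>" by (auto simp: slice_def embed1_def)
    \<comment> \<open>\<open>\<zeta>\<close> vanishes at \<open>e1\<close>, the one place where
      \<open>b\<close> does not act as \<open>c\<close>; so every admissible unit vector gives the
      same value.\<close>
    then have "b (embed1 G2 \<zeta>) (x, e2) = c * \<zeta> x" for x
      using bs[OF sup\<zeta>, of x] \<zeta>0[of e1] by (auto simp: embed1_def)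
    then have \<psi>: "vec_state (embed1 G2 \<zeta>) b = c"
      unfolding vec_state_def by (intro ell2_inner_embed1 \<zeta>(2)) simp
    define h where "h = a2 (w2 (delta e))"
    have h: "supported V h" "slice h = h"
      using sup1 gen_alg_S1(2) supW sup\<delta> a w unfolding h_def by blast+
    \<comment> \<open>The compression of \<open>b\<close> is \<open>c\<close> off the root and 0 at
      the root; the correction by \<open>delta e\<close> produces the product of the two states in
      condition (ii).\<close>
    have "slice (b h) = (\<lambda>v. c * h v + (- (c * h e)) * delta e v)"
    proof
      fix v
      obtain x y where v: "v = (x :: 'v1, y :: 'v2)" by (cases v)
      show "slice (b h) v = c * h v + (- (c * h e)) * delta e v"
        using fun_cong[OF h(2), of v] by (auto simp: v slice_def bs[OF h] delta_def split: if_splits)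
    qed
    then have "a1 (b h) = a1 (\<lambda>v. c * h v + (- (c * h e)) * delta e v)"
      using gen_alg_S1(1)[OF a(1) sup2[OF b h(1)]] by simp
    also have "\<dots> = (\<lambda>v. c * a1 h v + (- (c * h e)) * a1 (delta e) v)"
      by (simp only: lin_oper_add[OF lin1[OF a(1)]] lin_oper_scale[OF lin1[OF a(1)]])
    finally have "w1 (a1 (b h)) = w1 (\<lambda>v. c * a1 h v + (- (c * h e)) * a1 (delta e) v)"
      by (rule arg_cong)
    also have "\<dots> = (\<lambda>v. c * w1 (a1 h) v + (- (c * h e)) * w1 (a1 (delta e)) v)"
      by (simp only: lin_oper_add[OF linW[OF w(1)]] lin_oper_scale[OF linW[OF w(1)]])
    finally show ?thesis by (simp add: \<psi> h_def algebra_simps)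
  qed
  show ?thesis
    unfolding orthogonal_pair_def Let_def vec_state_delta using i ii by blast
qed

end

theorem theorem6p1:
  fixes G1 :: "('v1, 'e1) rgraph" and G2 :: "('v2, 'e2) rgraph"
    and \<mu>1 \<mu>2 :: "complex poly \<Rightarrow> complex"
    and G :: "('v1 \<times> 'v2, ('v1 \<times> 'v2, 'e1 + 'v1 \<times> 'e2) with_loops) cgraph"
    and R1 R2 Z :: "('v1 \<times> 'v2) oper" and \<phi> :: "('v1 \<times> 'v2) oper \<Rightarrow> complex"
  assumes "rooted_graph G1" and "rooted_graph G2"
    and "\<mu>1 = spectral_distribution G1" and "\<mu>2 = spectral_distribution G2"
    and "G = orth_loop_product G1 G2"
    and "R1 = color_adj G 1" and "R2 = color_adj G 2"
    and "Z = R2 \<circ> R1"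
    and "\<phi> = vec_state (delta (base G))"
  shows "(\<forall>n. N_coeff (distribution \<phi> Z) n = N_coeff (orth_mult_conv \<mu>1 \<mu>2) n \<and>
             finite (d_walks G (base G) (2 * n)) \<and>
             N_coeff (orth_mult_conv \<mu>1 \<mu>2) n = of_nat (card (d_walks G (base G) (2 * n)))) \<and>
         (\<forall>\<zeta> \<in> ell2 (verts G1 - {base G1}). ell2_inner \<zeta> \<zeta> = 1 \<longrightarrow>
           orthogonal_pair (R1 - id) (R2 - id) \<phi> (vec_state (embed1 G2 \<zeta>)))"
proof -
  interpret orth_loop G1 G2 using assms(1,2) by unfold_locales
  have \<phi>: "\<phi> = vec_state (delta e)" and base: "base G = e"
    using assms by (simp_all add: base_P)
  have R: "R1 = kernel_op C1" "R2 = kernel_op C2"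
    using color_adj_eq assms by simp_all
  have Z: "Z = kernel_op C2 \<circ> kernel_op C1" using assms(8) R by simp
  have eta: "eta_series (distribution \<phi> Z) = eta_series (orth_mult_conv \<mu>1 \<mu>2)"
    using eta_Z by (simp add: \<phi> Z assms(3,4))
  have "finite (d_walks G (base G) (2 * n)) \<and>
      N_coeff (orth_mult_conv \<mu>1 \<mu>2) n = of_nat (card (d_walks G (base G) (2 * n)))" for n
  proof (cases n)
    case 0
    \<comment> \<open>Both f-walks have length at least 1, so no d-walk has length 0; this matches
      the zero constant term of \<eta>.\<close>
    have "d_walks G (base G) 0 = {}"
      by (auto simp: d_walks_def alternating_d_walk_def f_walk_def walk_append_def walk_length_def)
    then show ?thesis by (simp add: 0 N_coeff_def orth_mult_conv(2))
  next
    case (Suc m)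
    have D: "d_walks G (base G) (2 * n) = path_set alt_graph alt_avoid e (2 * Suc m) e"
      using d_walks_eq_path_set[of n] Suc assms(5) base by simp
    \<comment> \<open>The factor \<open>fps_X\<close> shifts the index: order \<open>Suc m\<close>
      reads off the return coefficient \<open>m\<close>.\<close>
    have "N_coeff (orth_mult_conv \<mu>1 \<mu>2) n = return_coeff e Z m"
      by (simp add: N_coeff_def Suc \<phi> Z eta_series_first_return lin_oper_comp lin_oper_kernel_op
          flip: eta)
    also have "\<dots> = of_nat (card (path_set alt_graph alt_avoid e (2 * Suc m) e))"
      by (simp only: card_alt_paths return_coeff_def Z)
    finally show ?thesis
      unfolding D using card_path_set(1)[OF finite_joins_P finite_neighbours_P] by simp
  qed
  then show ?thesis
    using eta orthogonal_S1_S2 by (simp only: N_coeff_def \<phi> R) blast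
qed

end
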